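(* Let $N\ge 1$, let $\Omega\subset\mathbb{R}^N$ be a bounded open set, and let $A\in (L^\infty(\Omega))^{N\times N}$ and $\alpha>0$ be such that $A(x)\xi\cdot\xi\ge\alpha|\xi|^2$ for a.e. $x\in\Omega$ and all $\xi\in\mathbb{R}^N$. Let $F:\Omega\times[0,+\infty)\to[0,+\infty]$ be a Carathéodory function (i.e. $x\mapsto F(x,s)$ is measurable for every $s\in[0,+\infty)$, and for a.e. $x\in\Omega$ the map $s\mapsto F(x,s)\in[0,+\infty]$ is continuous on $[0,+\infty)$) such that $$0\le F(x,s)\le \frac{h(x)}{\Gamma(s)}\quad\text{for a.e. } x\in\Omega,\ \forall s>0,$$ where $h\ge 0$ a.e., $h\in L^r(\Omega)$ with $r=\frac{2N}{N+2}$ if $N\ge3$, $r>1$ if $N=2$, $r=1$ if $N=1$, and where $\Gamma:[0,+\infty)\to[0,+\infty)$ is of class $C^1([0,+\infty))$ with $\Gamma(0)=0$ and $\Gamma'(s)>0$ for all $s>0$. Then every solution $u$, in the sense of the definition given in the context, to the problem $u\ge 0$, $-\operatorname{div}A(x)Du=F(x,u)$ in $\Omega$, $u=0$ on $\partial\Omega$ satisfies $$\|\varphi DT_k(u)\|^2_{(L^2(\Omega))^N}\le\frac{32k^2}{\alpha^2}\|A\|^2_{(L^\infty(\Omega))^{N\times N}}\|D\varphi\|^2_{(L^2(\Omega))^N}+\frac{C_S^2}{\alpha^2}\frac{\|h\|^2_{L^r(\Omega)}}{\Gamma(k)^2}\|\varphi\|^2_{L^\infty(\Omega)}$$ for all $k>0$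 and all $\varphi\in H_0^1(\Omega)\cap L^\infty(\Omega)$, where $C_S$ is the (generalized) Sobolev constant described in the context.
   Context: All functions are real-valued unless otherwise said; $D$ denotes the gradient, ${}^tA$ the transpose of $A$, $\mathcal{D}(\Omega)=C_c^\infty(\Omega)$, $\mathcal{D}'(\Omega)$ the distributions on $\Omega$; no regularity of $\partial\Omega$ is assumed. $\|A\|_{(L^\infty(\Omega))^{N\times N}}$ is the essential supremum over $x\in\Omega$ of the Euclidean operator norm of $A(x)$. For $k>0$ and $s\in\mathbb{R}$: $T_k(s)=\max\{-k,\min\{s,k\}\}$, $G_k(s)=s-T_k(s)$. Sobolev constant. Let $2^*$ be the Hölder conjugate exponent of $r$: so $\frac1{2^*}=\frac12-\frac1N$ if $N\ge3$, $2^*=r/(r-1)\in(1,+\infty)$ if $N=2$, $2^*=+\infty$ if $N=1$. $C_S$ is a constant such that $\|v\|_{L^{2^*}(\Omega)}\le C_S\|Dv\|_{(L^2(\Omega))^N}$ for all $v\in H_0^1(\Omega)$. Test functions. For $\hat\varphi\in H_0^1(\Omega)\cap L^\infty(\Omega)$ and $\hat g\in(L^2(\Omega))^N$, the distribution $\hat\varphi(-\operatorname{div}\hat g)$ is defined by $\langle\hat\varphi(-\operatorname{div}\hat g),\phi\rangle=\int_\Omega\hat g\cdot D(\hat\varphi\phi)$ for $\phi\in\mathcal{D}(\Omega)$. The space $\mathcal{V}(\Omega)$ is the set of $v\in H_0^1(\Omega)\cap L^\infty(\Omega)$ for which there exist a finite set $I$, functions $\hat\varphi_i\in H_0^1(\Omega)\cap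 L^\infty(\Omega)$, $\hat g_i\in(L^2(\Omega))^N$ ($i\in I$) and $\hat f\in L^1(\Omega)$ such that $$-\operatorname{div}\,{}^tA(x)Dv=\sum_{i\in I}\hat\varphi_i(-\operatorname{div}\hat g_i)+\hat f\quad\text{in }\mathcal{D}'(\Omega).\qquad( * )$$ Definition of solution. A function $u$ is a solution to the problem $u\ge0$, $-\operatorname{div}A(x)Du=F(x,u)$ in $\Omega$, $u=0$ on $\partial\Omega$ if: (1) $u\in L^2(\Omega)\cap H^1_{\rm loc}(\Omega)$; $u(x)\ge0$ for a.e. $x\in\Omega$; $G_k(u)\in H_0^1(\Omega)$ for all $k>0$; and $\varphi T_k(u)\in H_0^1(\Omega)$ for all $k>0$ and all $\varphi\in H_0^1(\Omega)\cap L^\infty(\Omega)$; (2) for every $v\in\mathcal{V}(\Omega)$ with $v\ge0$, and every $I,\hat\varphi_i,\hat g_i,\hat f$ as in $( * )$, one has $\int_\Omega F(x,u)v<+\infty$ (with the usual convention $0\cdot\infty=0$ in integrands) and $$\int_\Omega{}^tA(x)Dv\cdot DG_k(u)+\sum_{i\in I}\int_\Omega\hat g_i\cdot D(\hat\varphi_iT_k(u))+\int_\Omega\hat f\,T_k(u)=\int_\Omega F(x,u)v\qquad\forall k>0.$$ *)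

theory Defs
  imports "HOL-Analysis.Analysis" "HOL-Probability.Essential_Supremum"
begin

text \<open>
  Functions on \<open>\<Omega>\<close> are represented by total functions; only their values on \<open>\<Omega>\<close>, up to null sets
  of Lebesgue measure on \<open>\<Omega>\<close>, matter. Since the Bochner integral of a non-integrable function is
  \<open>0\<close>, \<open>Lp_norm\<close> is meaningful only for members of \<open>Lp_space\<close>; wherever finiteness of a norm is
  part of a claim, membership is stated explicitly. The same exponent \<open>p \<in> [1, \<infinity>]\<close> is used for
  scalar and for vector valued functions, with the Euclidean norm on the values.
\<close>

definition Lp_space :: "ereal \<Rightarrow> (real^'n) set \<Rightarrow> (real^'n \<Rightarrow> 'b::euclidean_space) set" where
  "Lp_space p \<Omega> = {f \<in> borel_measurable (lebesgue_on \<Omega>).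
     if p = \<infinity> then \<exists>C. AE x in lebesgue_on \<Omega>. norm (f x) \<le> C
     else integrable (lebesgue_on \<Omega>) (\<lambda>x. norm (f x) powr real_of_ereal p)}"

definition Lp_norm :: "ereal \<Rightarrow> (real^'n) set \<Rightarrow> (real^'n \<Rightarrow> 'b::euclidean_space) \<Rightarrow> real" where
  "Lp_norm p \<Omega> f =
     (if p = \<infinity> then enn2real (esssup (lebesgue_on \<Omega>) (\<lambda>x. ennreal (norm (f x))))
      else (\<integral>x. norm (f x) powr real_of_ereal p \<partial>lebesgue_on \<Omega>) powr (1 / real_of_ereal p))"

definition Lp_loc :: "ereal \<Rightarrow> (real^'n) set \<Rightarrow> (real^'n \<Rightarrow> 'b::euclidean_space) set" where
  "Lp_loc p \<Omega> = {f \<in> borel_measurable (lebesgue_on \<Omega>).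
     \<forall>K. compact K \<and> K \<subseteq> \<Omega> \<longrightarrow> f \<in> Lp_space p K}"

definition matrix_Linf_norm :: "(real^'n) set \<Rightarrow> (real^'n \<Rightarrow> real^'n^'n) \<Rightarrow> real" where
  "matrix_Linf_norm \<Omega> A = Lp_norm \<infinity> \<Omega> (\<lambda>x. onorm ((*v) (A x)))"

definition holder_conjugate :: "real \<Rightarrow> ereal" where
  "holder_conjugate r = (if r = 1 then \<infinity> else ereal (r / (r - 1)))"

definition partial_deriv :: "'n \<Rightarrow> (real^'n \<Rightarrow> real) \<Rightarrow> real^'n \<Rightarrow> real" where
  "partial_deriv i f x = frechet_derivative f (at x) (axis i 1)"

definition classical_grad :: "(real^'n \<Rightarrow> real) \<Rightarrow> real^'n \<Rightarrow> real^'n" where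
  "classical_grad f x = (\<chi> i. partial_deriv i f x)"

primrec Ck :: "nat \<Rightarrow> (real^'n \<Rightarrow> real) \<Rightarrow> bool" where
  "Ck 0 f \<longleftrightarrow> continuous_on UNIV f"
| "Ck (Suc k) f \<longleftrightarrow> (\<forall>x. f differentiable (at x)) \<and> (\<forall>i. Ck k (partial_deriv i f))"

text \<open>Elements of \<open>C\<^sub>c\<^sup>\<infinity>(\<Omega>)\<close>, extended by \<open>0\<close> to the whole space.\<close>

definition test_functions :: "(real^'n) set \<Rightarrow> (real^'n \<Rightarrow> real) set" where
  "test_functions \<Omega> = {\<phi>. (\<forall>k. Ck k \<phi>) \<and> compact (closure {x. \<phi> x \<noteq> 0})
     \<and> closure {x. \<phi> x \<noteq> 0} \<subseteq> \<Omega>}"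

definition has_weak_gradient ::
  "(real^'n) set \<Rightarrow> (real^'n \<Rightarrow> real) \<Rightarrow> (real^'n \<Rightarrow> real^'n) \<Rightarrow> bool" where
  "has_weak_gradient \<Omega> u g \<longleftrightarrow> u \<in> Lp_loc 1 \<Omega> \<and> g \<in> Lp_loc 1 \<Omega> \<and>
     (\<forall>\<phi>\<in>test_functions \<Omega>. \<forall>i.
        (\<integral>x. u x * partial_deriv i \<phi> x \<partial>lebesgue_on \<Omega>) = - (\<integral>x. g x $ i * \<phi> x \<partial>lebesgue_on \<Omega>))"

text \<open>The weak gradient is unique up to null sets, so the choice of representative is immaterial.\<close>

definition weak_grad :: "(real^'n) set \<Rightarrow> (real^'n \<Rightarrow> real) \<Rightarrow> real^'n \<Rightarrow> real^'n" where
  "weak_grad \<Omega> u = (SOME g. has_weak_gradient \<Omega> u g)"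

definition H1 :: "(real^'n) set \<Rightarrow> (real^'n \<Rightarrow> real) set" where
  "H1 \<Omega> = {u \<in> Lp_space 2 \<Omega>. \<exists>g \<in> Lp_space 2 \<Omega>. has_weak_gradient \<Omega> u g}"

definition H1_norm :: "(real^'n) set \<Rightarrow> (real^'n \<Rightarrow> real) \<Rightarrow> real" where
  "H1_norm \<Omega> u = sqrt ((Lp_norm 2 \<Omega> u)\<^sup>2 + (Lp_norm 2 \<Omega> (weak_grad \<Omega> u))\<^sup>2)"

definition H1_loc :: "(real^'n) set \<Rightarrow> (real^'n \<Rightarrow> real) set" where
  "H1_loc \<Omega> = {u \<in> Lp_loc 2 \<Omega>. \<exists>g \<in> Lp_loc 2 \<Omega>. has_weak_gradient \<Omega> u g}"

text \<open>The closure of the test functions in \<open>H1 \<Omega>\<close>.\<close>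

definition H10 :: "(real^'n) set \<Rightarrow> (real^'n \<Rightarrow> real) set" where
  "H10 \<Omega> = {u \<in> H1 \<Omega>. \<forall>e>0. \<exists>\<phi>\<in>test_functions \<Omega>. H1_norm \<Omega> (\<lambda>x. u x - \<phi> x) < e}"

definition sobolev_constant :: "(real^'n) set \<Rightarrow> ereal \<Rightarrow> real \<Rightarrow> bool" where
  "sobolev_constant \<Omega> p C \<longleftrightarrow> (\<forall>v\<in>H10 \<Omega>. v \<in> Lp_space p \<Omega> \<and>
     Lp_norm p \<Omega> v \<le> C * Lp_norm 2 \<Omega> (weak_grad \<Omega> v))"

definition trunc :: "real \<Rightarrow> real \<Rightarrow> real" where
  "trunc k s = max (- k) (min s k)"

definition trunc_rest :: "real \<Rightarrow> real \<Rightarrow> real" where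
  "trunc_rest k s = s - trunc k s"

text \<open>The distributions occurring below, as functionals on the test functions.\<close>

definition distr_fun :: "(real^'n) set \<Rightarrow> (real^'n \<Rightarrow> real) \<Rightarrow> (real^'n \<Rightarrow> real) \<Rightarrow> real" where
  "distr_fun \<Omega> f \<phi> = (\<integral>x. f x * \<phi> x \<partial>lebesgue_on \<Omega>)"

definition distr_neg_div ::
  "(real^'n) set \<Rightarrow> (real^'n \<Rightarrow> real^'n) \<Rightarrow> (real^'n \<Rightarrow> real) \<Rightarrow> real" where
  "distr_neg_div \<Omega> g \<phi> = (\<integral>x. g x \<bullet> classical_grad \<phi> x \<partial>lebesgue_on \<Omega>)"

text \<open>The product \<open>\<psi> (- div g)\<close> for \<open>\<psi> \<in> H\<^sub>0\<^sup>1 \<inter> L\<^sup>\<infinity>\<close> and \<open>g \<in> L\<^sup>2\<close>.\<close>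

definition distr_mult_neg_div ::
  "(real^'n) set \<Rightarrow> (real^'n \<Rightarrow> real) \<Rightarrow> (real^'n \<Rightarrow> real^'n) \<Rightarrow> (real^'n \<Rightarrow> real) \<Rightarrow> real" where
  "distr_mult_neg_div \<Omega> \<psi> g \<phi> = (\<integral>x. g x \<bullet> weak_grad \<Omega> (\<lambda>y. \<psi> y * \<phi> y) x \<partial>lebesgue_on \<Omega>)"

text \<open>Finite index sets are taken, without loss of generality, to be sets of natural numbers.\<close>

definition V_decomposition ::
  "(real^'n) set \<Rightarrow> (real^'n \<Rightarrow> real^'n^'n) \<Rightarrow> (real^'n \<Rightarrow> real) \<Rightarrow> nat set \<Rightarrow>
   (nat \<Rightarrow> real^'n \<Rightarrow> real) \<Rightarrow> (nat \<Rightarrow> real^'n \<Rightarrow> real^'n) \<Rightarrow> (real^'n \<Rightarrow> real) \<Rightarrow> bool" where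
  "V_decomposition \<Omega> A v I \<psi> g f \<longleftrightarrow>
     finite I \<and> (\<forall>i\<in>I. \<psi> i \<in> H10 \<Omega> \<inter> Lp_space \<infinity> \<Omega>) \<and> (\<forall>i\<in>I. g i \<in> Lp_space 2 \<Omega>) \<and>
     f \<in> Lp_space 1 \<Omega> \<and>
     (\<forall>\<phi>\<in>test_functions \<Omega>.
        distr_neg_div \<Omega> (\<lambda>x. transpose (A x) *v weak_grad \<Omega> v x) \<phi> =
        (\<Sum>i\<in>I. distr_mult_neg_div \<Omega> (\<psi> i) (g i) \<phi>) + distr_fun \<Omega> f \<phi>)"

definition V_space :: "(real^'n) set \<Rightarrow> (real^'n \<Rightarrow> real^'n^'n) \<Rightarrow> (real^'n \<Rightarrow> real) set" where
  "V_space \<Omega> A = {v \<in> H10 \<Omega> \<inter> Lp_space \<infinity> \<Omega>. \<exists>I \<psi> g f. V_decomposition \<Omega> A v I \<psi> g f}"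

definition caratheodory :: "(real^'n) set \<Rightarrow> (real^'n \<Rightarrow> real \<Rightarrow> ennreal) \<Rightarrow> bool" where
  "caratheodory \<Omega> F \<longleftrightarrow>
     (\<forall>s\<ge>0. (\<lambda>x. F x s) \<in> borel_measurable (lebesgue_on \<Omega>)) \<and>
     (AE x in lebesgue_on \<Omega>. continuous_on {0..} (F x))"

text \<open>In \<^typ>\<open>ennreal\<close> one has \<open>0 * \<infinity> = 0\<close>, the convention used in the integrand \<open>F(x,u) v\<close>.\<close>

definition is_solution ::
  "(real^'n) set \<Rightarrow> (real^'n \<Rightarrow> real^'n^'n) \<Rightarrow> (real^'n \<Rightarrow> real \<Rightarrow> ennreal) \<Rightarrow>
   (real^'n \<Rightarrow> real) \<Rightarrow> bool" where
  "is_solution \<Omega> A F u \<longleftrightarrow>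
     u \<in> Lp_space 2 \<Omega> \<inter> H1_loc \<Omega> \<and>
     (AE x in lebesgue_on \<Omega>. u x \<ge> 0) \<and>
     (\<forall>k>0. (\<lambda>x. trunc_rest k (u x)) \<in> H10 \<Omega>) \<and>
     (\<forall>k>0. \<forall>\<phi>\<in>H10 \<Omega> \<inter> Lp_space \<infinity> \<Omega>. (\<lambda>x. \<phi> x * trunc k (u x)) \<in> H10 \<Omega>) \<and>
     (\<forall>v\<in>V_space \<Omega> A. (AE x in lebesgue_on \<Omega>. v x \<ge> 0) \<longrightarrow>
       (\<forall>I \<psi> g f. V_decomposition \<Omega> A v I \<psi> g f \<longrightarrow>
          (\<integral>\<^sup>+x. F x (u x) * ennreal (v x) \<partial>lebesgue_on \<Omega>) < \<infinity> \<and>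
          (\<forall>k>0.
            (\<integral>x. (transpose (A x) *v weak_grad \<Omega> v x) \<bullet>
                   weak_grad \<Omega> (\<lambda>y. trunc_rest k (u y)) x \<partial>lebesgue_on \<Omega>)
            + (\<Sum>i\<in>I. \<integral>x. g i x \<bullet> weak_grad \<Omega> (\<lambda>y. \<psi> i y * trunc k (u y)) x \<partial>lebesgue_on \<Omega>)
            + (\<integral>x. f x * trunc k (u x) \<partial>lebesgue_on \<Omega>)
            = enn2real (\<integral>\<^sup>+x. F x (u x) * ennreal (v x) \<partial>lebesgue_on \<Omega>))))"

end

theory Submission
  imports Defs
begin

text \<open>
  The estimate is a Caccioppoli inequality for supersolutions. Since \<open>F \<ge> 0\<close>, a solution satisfies
  \<open>- div (A D u) \<ge> 0\<close> in the weak sense, and it may be tested with \<open>v = \<phi>\<^sup>2 (k - T\<^sub>k(u))\<close>, which is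
  nonnegative. On \<open>{u \<ge> k}\<close> both \<open>k - T\<^sub>k(u)\<close> and its gradient vanish almost everywhere, so only
  \<open>D T\<^sub>k(u)\<close> survives and
  \<open>\<integral> \<phi>\<^sup>2 A D T\<^sub>k(u) \<cdot> D T\<^sub>k(u) \<le> 2 \<integral> \<phi> (k - T\<^sub>k(u)) A D T\<^sub>k(u) \<cdot> D \<phi>\<close>.
  Ellipticity on the left, \<open>0 \<le> k - T\<^sub>k(u) \<le> k\<close> and Young's inequality on the right give
  \<open>\<parallel>\<phi> D T\<^sub>k(u)\<parallel>\<^sup>2 \<le> 4 k\<^sup>2 / \<alpha>\<^sup>2 \<parallel>A\<parallel>\<^sup>2 \<parallel>D \<phi>\<parallel>\<^sup>2\<close>,
  which is dominated by the first summand of the claim; the second summand is nonnegative.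

  Testing is legitimate for \<open>\<phi> \<in> C\<^sub>c\<^sup>\<infinity>\<close>: then \<open>\<phi>\<^sup>2\<close> and \<open>\<phi>\<close> are test functions themselves, the products
  \<open>\<phi> T\<^sub>k(u)\<close> and \<open>\<phi>\<^sup>2 T\<^sub>k(u)\<close> lie in \<open>H10\<close> by the definition of a solution, and products only ever have
  one nonsmooth factor (\<open>caccioppoli_test_function\<close>). General \<open>\<phi>\<close> follow by approximation and Fatou's
  lemma (\<open>caccioppoli_H10\<close>), at the price of a factor \<open>2\<close>.

  The Sobolev theory behind this consists of three facts: weak gradients are unique almost
  everywhere (\<open>has_weak_gradient_unique\<close>), obtained from bump functions on boxes and Lebesgue
  differentiation; products with test functions obey the product rule
  (\<open>has_weak_gradient_test_function_mult\<close>); and the gradient of a function in \<open>H10\<close> vanishes on its zero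
  set (\<open>H10_weak_grad_eq_0_on_zero_set\<close>), by a chain rule proved with the approximating test functions
  that membership in \<open>H10\<close> provides.
\<close>

section \<open>Test functions\<close>

lemma partial_deriv_eq:
  "(f has_derivative f') (at x) \<Longrightarrow> partial_deriv i f x = f' (axis i 1)"
  unfolding partial_deriv_def using frechet_derivative_at by metis

lemma partial_deriv_const [simp]: "partial_deriv i (\<lambda>x. c) = (\<lambda>x. 0)"
  by (rule ext) (subst partial_deriv_eq[OF has_derivative_const], simp)

lemma partial_deriv_add:
  assumes "f differentiable (at x)" "g differentiable (at x)"
  shows "partial_deriv i (\<lambda>x. f x + g x) x = partial_deriv i f x + partial_deriv i g x"
  by (subst partial_deriv_eq[OF has_derivative_add[OF assms[unfolded frechet_derivative_works]]])
    (simp add: partial_deriv_def)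

lemma partial_deriv_mult:
  assumes "f differentiable (at x)" "g differentiable (at x)"
  shows "partial_deriv i (\<lambda>x. f x * g x) x = f x * partial_deriv i g x + partial_deriv i f x * g x"
  by (subst partial_deriv_eq[OF has_derivative_mult[OF assms[unfolded frechet_derivative_works]]])
    (simp add: partial_deriv_def)

lemma partial_deriv_compose_real:
  fixes H :: "real \<Rightarrow> real"
  assumes "(H has_real_derivative d) (at (f x))" "f differentiable (at x)"
  shows "partial_deriv i (\<lambda>x. H (f x)) x = d * partial_deriv i f x"
proof -
  have "((\<lambda>x. H (f x)) has_derivative (\<lambda>y. d * frechet_derivative f (at x) y)) (at x)"
    using has_derivative_compose[OF assms(2)[unfolded frechet_derivative_works]
        assms(1)[unfolded has_field_derivative_def]] by simp
  from partial_deriv_eq[OF this] show ?thesis by (simp add: partial_deriv_def)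
qed

lemma Ck_Suc_imp_Ck: "Ck (Suc k) f \<Longrightarrow> Ck k f"
proof (induction k arbitrary: f)
  case 0
  then show ?case
    by (auto simp: continuous_on_eq_continuous_at intro: differentiable_imp_continuous_within)
qed auto

lemma Ck_const: "Ck k (\<lambda>x. c)"
  by (induction k arbitrary: c) auto

lemma Ck_add: "Ck k f \<Longrightarrow> Ck k g \<Longrightarrow> Ck k (\<lambda>x. f x + g x)"
proof (induction k arbitrary: f g)
  case (Suc k)
  have "partial_deriv i (\<lambda>x. f x + g x) = (\<lambda>x. partial_deriv i f x + partial_deriv i g x)" for i
    using Suc.prems by (auto simp: partial_deriv_add)
  with Suc show ?case by (simp add: differentiable_add)
qed (auto intro: continuous_intros)

lemma Ck_mult: "Ck k f \<Longrightarrow> Ck k g \<Longrightarrow> Ck k (\<lambda>x. f x * g x)"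
proof (induction k arbitrary: f g)
  case (Suc k)
  have "partial_deriv i (\<lambda>x. f x * g x)
      = (\<lambda>x. f x * partial_deriv i g x + partial_deriv i f x * g x)" for i
    using Suc.prems by (auto simp: partial_deriv_mult)
  moreover have "Ck k f" "Ck k g"
    using Suc.prems Ck_Suc_imp_Ck by blast+
  ultimately show ?case
    using Suc by (auto intro!: Ck_add differentiable_mult)
qed (auto intro: continuous_intros)

lemma Ck_prod: "finite I \<Longrightarrow> (\<And>i. i \<in> I \<Longrightarrow> Ck k (f i)) \<Longrightarrow> Ck k (\<lambda>x. \<Prod>i\<in>I. f i x)"
  by (induction I rule: finite_induct) (auto intro: Ck_const Ck_mult)

lemma Ck_1_iff: "Ck (Suc 0) f \<longleftrightarrow>
    (\<forall>x. f differentiable (at x)) \<and> (\<forall>i. continuous_on UNIV (partial_deriv i f))"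
  by simp

text \<open>
  For \<open>p = 1\<close> this is the classical smooth function vanishing to infinite order at \<open>0\<close>. The polynomial
  factor makes the family closed under differentiation, so that smoothness is an induction over the
  order with one derivative formula.
\<close>

definition exp_bump :: "real poly \<Rightarrow> real \<Rightarrow> real" where
  "exp_bump p t = (if t > 0 then poly p (1 / t) * exp (- (1 / t)) else 0)"

lemma tendsto_poly_mult_exp_minus_at_top: "((\<lambda>s::real. poly p s * exp (- s)) \<longlongrightarrow> 0) at_top"
proof -
  have "((\<lambda>s::real. \<Sum>i\<le>degree p. coeff p i * (s ^ i / exp s)) \<longlongrightarrow> (\<Sum>i\<le>degree p. coeff p i * 0)) at_top"
    by (intro tendsto_sum tendsto_mult tendsto_const tendsto_power_div_exp_0)
  then show ?thesis
    by (simp add: poly_altdef exp_minus inverse_eq_divide sum_divide_distrib)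
qed

lemma exp_bump_tendsto_0: "(exp_bump p \<longlongrightarrow> 0) (at 0)"
proof (rule filterlim_split_at)
  show "(exp_bump p \<longlongrightarrow> 0) (at_left 0)"
    by (rule Lim_transform_eventually[of "\<lambda>_. 0"])
      (auto simp: exp_bump_def eventually_at_filter)
  have "((\<lambda>t. poly p (inverse t) * exp (- (inverse t))) \<longlongrightarrow> 0) (at_right (0::real))"
    by (rule filterlim_compose[OF tendsto_poly_mult_exp_minus_at_top filterlim_inverse_at_top_right])
  then show "(exp_bump p \<longlongrightarrow> 0) (at_right 0)"
    by (rule Lim_transform_eventually)
      (auto simp: exp_bump_def eventually_at_filter inverse_eq_divide)
qed

text \<open>
  The only delicate point is \<open>t = 0\<close>: the difference quotient there is again a member of the family,
  with the polynomial multiplied by the variable, and every member tends to \<open>0\<close> at \<open>0\<close>.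
\<close>

lemma exp_bump_deriv:
  "(exp_bump p has_real_derivative exp_bump ([:0, 0, 1:] * (p - pderiv p)) t) (at t)"
proof (cases t "0::real" rule: linorder_cases)
  case less
  show ?thesis
    by (rule has_field_derivative_transform_within_open[of "\<lambda>_. 0" _ _ "{..<0}"])
      (use less in \<open>auto simp: exp_bump_def\<close>)
next
  case greater
  have "((\<lambda>t. poly p (1 / t) * exp (- (1 / t))) has_real_derivative
      exp_bump ([:0, 0, 1:] * (p - pderiv p)) t) (at t)"
  proof -
    have i: "((\<lambda>t::real. 1 / t) has_real_derivative - ((1 / t) * (1 / t))) (at t)"
      using greater by (auto intro!: derivative_eq_intros)
    have "- (s * s) * c * e + e * (s * s) * d = s * s * (d - c) * e" for s c d e :: real
      by algebra
    note eq = this[of "1 / t" "poly (pderiv p) (1 / t)" "exp (- (1 / t))" "poly p (1 / t)"]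
    show ?thesis
      by (rule DERIV_cong[OF DERIV_mult[OF DERIV_chain2[OF poly_DERIV i]
            DERIV_chain2[OF DERIV_exp DERIV_minus[OF i]]]])
        (use greater eq in \<open>simp add: exp_bump_def mult_ac\<close>)
  qed
  from has_field_derivative_transform_within_open[OF this, of "{0<..}"] show ?thesis
    using greater by (auto simp: exp_bump_def)
next
  case equal
  have "((\<lambda>h. (exp_bump p (0 + h) - exp_bump p 0) / h) \<longlongrightarrow> 0) (at 0)"
    by (rule Lim_transform_eventually[OF exp_bump_tendsto_0[of "pCons 0 p"]])
      (auto simp: exp_bump_def eventually_at_filter)
  then show ?thesis
    using equal by (simp add: has_field_derivative_iff exp_bump_def)
qed

lemma Ck_exp_bump_affine: "Ck k (\<lambda>x. exp_bump p (c * x $ i + d))"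
proof (induction k arbitrary: p)
  case 0
  have "continuous_on UNIV (exp_bump p)"
    using exp_bump_deriv DERIV_isCont by (metis continuous_at_imp_continuous_on)
  then show ?case
    by (auto intro!: continuous_intros continuous_on_compose2[of UNIV "exp_bump p"])
next
  case (Suc k)
  let ?l = "\<lambda>x. c * x $ i + d"
  have l: "(?l has_derivative (\<lambda>y. c * y $ i)) (at x)" for x
    by (auto intro!: derivative_eq_intros bounded_linear.has_derivative[OF bounded_linear_vec_nth])
  have l': "?l differentiable (at x)" for x
    using l differentiable_def by blast
  have pd: "partial_deriv j (\<lambda>x. exp_bump p (?l x))
      = (\<lambda>x. exp_bump ([:0, 0, 1:] * (p - pderiv p)) (?l x) * (c * axis j 1 $ i))" for j
    by (rule ext) (subst partial_deriv_compose_real[OF exp_bump_deriv l'], simp add: partial_deriv_eq[OF l])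
  have d: "(\<lambda>x. exp_bump p (?l x)) differentiable (at x)" for x
    using differentiable_chain_at[OF l'[of x]
        differentiableI[OF has_field_derivative_imp_has_derivative[OF exp_bump_deriv]]]
    by (simp only: o_def)
  show ?case
    unfolding Ck.simps pd by (intro conjI allI d Ck_mult[OF Suc Ck_const])
qed

text \<open>
  The parameter \<open>m\<close> rescales the transition layer: on the open box the factors are
  \<open>exp (- 1 / (m * distance))\<close>, hence increase to \<open>1\<close> with \<open>m\<close>. This yields the indicator of a box as a
  bounded pointwise limit of test functions without any cutoff or convolution.
\<close>

definition box_bump :: "real \<Rightarrow> real^'n \<Rightarrow> real^'n \<Rightarrow> real^'n \<Rightarrow> real" where
  "box_bump m a b x = (\<Prod>i\<in>UNIV. exp_bump 1 (m * x $ i + - m * a $ i) * exp_bump 1 (- m * x $ i + m * b $ i))"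

lemma Ck_box_bump: "Ck k (box_bump m a b)"
  unfolding box_bump_def by (intro Ck_prod Ck_mult Ck_exp_bump_affine) auto

lemma box_bump_eq_0:
  assumes "m > 0" "x \<notin> box a b"
  shows "box_bump m a b x = 0"
proof -
  obtain i where i: "x $ i \<le> a $ i \<or> b $ i \<le> x $ i"
    using assms(2) by (auto simp: mem_box_cart not_less)
  then have "m * x $ i \<le> m * a $ i \<or> m * b $ i \<le> m * x $ i"
    using assms(1) by auto
  then show ?thesis
    unfolding box_bump_def by (subst prod_zero_iff) (auto simp: exp_bump_def intro!: exI[of _ i])
qed

lemma box_bump_le_1: "0 \<le> box_bump m a b x \<and> box_bump m a b x \<le> 1"
proof -
  have 1: "0 \<le> exp_bump 1 t \<and> exp_bump 1 t \<le> 1" for t by (simp add: exp_bump_def)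
  show ?thesis
    unfolding box_bump_def using 1
    by (auto intro!: prod_nonneg prod_le_1 mult_le_one)
qed

lemma box_bump_tendsto: "(\<lambda>n. box_bump (real (Suc n)) a b x) \<longlonglongrightarrow> indicator (box a b) x"
proof (cases "x \<in> box a b")
  case False
  then show ?thesis by (simp add: box_bump_eq_0)
next
  case True
  have 1: "(\<lambda>n. exp_bump 1 (real (Suc n) * t)) \<longlonglongrightarrow> 1" if "t > 0" for t
  proof -
    have "(\<lambda>n. exp (- (inverse (real (Suc n)) * (1 / t)))) \<longlonglongrightarrow> exp (- (0 * (1 / t)))"
      by (intro tendsto_intros LIMSEQ_inverse_real_of_nat)
    then show ?thesis
      using that by (simp add: exp_bump_def zero_less_mult_iff inverse_eq_divide)
  qed
  have "(\<lambda>n. box_bump (real (Suc n)) a b x) \<longlonglongrightarrow> (\<Prod>i\<in>(UNIV::'a set). 1 * 1)"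
    unfolding box_bump_def
  proof (intro tendsto_prod tendsto_mult)
    fix i
    show "(\<lambda>n. exp_bump 1 (real (Suc n) * x $ i + - real (Suc n) * a $ i)) \<longlonglongrightarrow> 1"
      using 1[of "x $ i - a $ i"] True by (simp add: mem_box_cart algebra_simps)
    show "(\<lambda>n. exp_bump 1 (- real (Suc n) * x $ i + real (Suc n) * b $ i)) \<longlonglongrightarrow> 1"
      using 1[of "b $ i - x $ i"] True by (simp add: mem_box_cart algebra_simps)
  qed
  then show ?thesis using True by simp
qed

lemma test_function_box_bump:
  assumes "cbox a b \<subseteq> \<Omega>" "m > 0"
  shows "box_bump m a b \<in> test_functions \<Omega>"
proof -
  have "{x. box_bump m a b x \<noteq> 0} \<subseteq> cbox a b"
    using box_bump_eq_0[OF assms(2)] box_subset_cbox by blast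
  then have *: "closure {x. box_bump m a b x \<noteq> 0} \<subseteq> cbox a b"
    by (intro closure_minimal closed_cbox)
  moreover have "compact (closure {x. box_bump m a b x \<noteq> 0})"
    using * bounded_subset[OF bounded_cbox] by (auto simp: compact_eq_bounded_closed)
  ultimately show ?thesis
    using assms by (auto simp: test_functions_def Ck_box_bump)
qed

lemma test_function_Ck: "\<phi> \<in> test_functions \<Omega> \<Longrightarrow> Ck k \<phi>"
  by (simp add: test_functions_def)

lemma test_function_differentiable: "\<phi> \<in> test_functions \<Omega> \<Longrightarrow> \<phi> differentiable (at x)"
  using test_function_Ck[of \<phi> \<Omega> "Suc 0"] by simp

lemma test_function_continuous: "\<phi> \<in> test_functions \<Omega> \<Longrightarrow> continuous_on UNIV \<phi>"
  using test_function_Ck[of \<phi> \<Omega> 0] by simp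

lemma compact_if_closed_subset: "compact T \<Longrightarrow> closed S \<Longrightarrow> S \<subseteq> T \<Longrightarrow> compact S"
  for S T :: "'a::t2_space set"
  using compact_Int_closed[of T S] by (simp only: Int_absorb1)

lemma in_closure_support: "f x \<noteq> 0 \<Longrightarrow> x \<in> closure {x. f x \<noteq> 0}"
  using closure_subset[of "{x. f x \<noteq> 0}"] by auto

lemma test_function_subset_supp:
  assumes "\<phi> \<in> test_functions \<Omega>" "\<And>k. Ck k \<psi>" "{x. \<psi> x \<noteq> 0} \<subseteq> closure {x. \<phi> x \<noteq> 0}"
  shows "\<psi> \<in> test_functions \<Omega>"
proof -
  have *: "closure {x. \<psi> x \<noteq> 0} \<subseteq> closure {x. \<phi> x \<noteq> 0}"
    using closure_minimal[OF assms(3)] by simp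
  have "compact (closure {x. \<phi> x \<noteq> 0})" "closure {x. \<phi> x \<noteq> 0} \<subseteq> \<Omega>"
    using assms(1) unfolding test_functions_def by auto
  then have "compact (closure {x. \<psi> x \<noteq> 0})" "closure {x. \<psi> x \<noteq> 0} \<subseteq> \<Omega>"
    using compact_if_closed_subset[OF _ closed_closure *] order_trans[OF *] by simp_all
  then show ?thesis
    unfolding test_functions_def using assms(2) by simp
qed

lemma test_function_mult:
  "\<phi> \<in> test_functions \<Omega> \<Longrightarrow> (\<And>k. Ck k \<psi>) \<Longrightarrow> (\<lambda>x. \<phi> x * \<psi> x) \<in> test_functions \<Omega>"
  by (rule test_function_subset_supp[of \<phi>])
    (auto intro: Ck_mult test_function_Ck in_closure_support[of \<phi>])

lemma test_function_partial_deriv: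
  assumes "\<phi> \<in> test_functions \<Omega>"
  shows "partial_deriv i \<phi> \<in> test_functions \<Omega>"
proof (rule test_function_subset_supp[OF assms])
  show "Ck k (partial_deriv i \<phi>)" for k
    using test_function_Ck[OF assms, of "Suc k"] by simp
  show "{x. partial_deriv i \<phi> x \<noteq> 0} \<subseteq> closure {x. \<phi> x \<noteq> 0}"
  proof (rule subsetI, rule ccontr)
    fix x assume x: "x \<in> {x. partial_deriv i \<phi> x \<noteq> 0}" "x \<notin> closure {x. \<phi> x \<noteq> 0}"
    have "(\<phi> has_derivative (\<lambda>_. 0)) (at x)"
      by (rule has_derivative_transform_within_open[of "\<lambda>_. 0" _ _ _ "- closure {x. \<phi> x \<noteq> 0}"])
        (use x(2) in_closure_support[of \<phi>] in auto)
    from partial_deriv_eq[OF this] x(1) show False by simp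
  qed
qed

lemma test_function_diff:
  assumes "\<phi> \<in> test_functions \<Omega>" "\<psi> \<in> test_functions \<Omega>"
  shows "(\<lambda>x. \<phi> x - \<psi> x) \<in> test_functions \<Omega>"
proof -
  let ?S = "closure {x. \<phi> x \<noteq> 0}" and ?T = "closure {x. \<psi> x \<noteq> 0}"
  have "Ck k (\<lambda>x. \<phi> x + - 1 * \<psi> x)" for k
    using assms by (intro Ck_add Ck_mult Ck_const test_function_Ck)
  moreover have sub: "closure {x. \<phi> x - \<psi> x \<noteq> 0} \<subseteq> ?S \<union> ?T"
  proof (rule closure_minimal)
    show "{x. \<phi> x - \<psi> x \<noteq> 0} \<subseteq> ?S \<union> ?T"
      using in_closure_support[of \<phi>] in_closure_support[of \<psi>] by force
  qed (intro closed_Un closed_closure)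
  moreover have "compact (?S \<union> ?T)"
    using assms by (auto simp only: test_functions_def intro!: compact_Un)
  then have "compact (closure {x. \<phi> x - \<psi> x \<noteq> 0})"
    by (rule compact_if_closed_subset[OF _ closed_closure sub])
  moreover have "?S \<union> ?T \<subseteq> \<Omega>"
    using assms unfolding test_functions_def by simp
  then have "closure {x. \<phi> x - \<psi> x \<noteq> 0} \<subseteq> \<Omega>"
    by (rule order_trans[OF sub])
  ultimately show ?thesis
    unfolding test_functions_def by simp
qed

section \<open>Integration against test functions\<close>

lemma sets_lebesgue_open: "open S \<Longrightarrow> S \<in> sets lebesgue"
  by simp

lemma borel_measurable_lebesgue_on_continuous:
  "continuous_on UNIV f \<Longrightarrow> f \<in> borel_measurable (lebesgue_on \<Omega>)"
  for f :: "'a::euclidean_space \<Rightarrow> 'b::topological_space"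
  by (intro measurable_restrict_space1 measurable_completion) (simp add: borel_measurable_continuous_onI)

lemma continuous_bounded_on_compact:
  fixes f :: "'a::topological_space \<Rightarrow> 'b::real_normed_vector"
  assumes "continuous_on UNIV f" "compact K"
  obtains C where "\<And>x. x \<in> K \<Longrightarrow> norm (f x) \<le> C"
  using compact_imp_bounded[OF compact_continuous_image[OF continuous_on_subset[OF assms(1)] assms(2)]]
  unfolding bounded_iff by blast

lemma Lp_loc_1_iff:
  "f \<in> Lp_loc 1 \<Omega> \<longleftrightarrow> f \<in> borel_measurable (lebesgue_on \<Omega>) \<and>
     (\<forall>K. compact K \<and> K \<subseteq> \<Omega> \<longrightarrow> integrable (lebesgue_on K) f)"
proof -
  have "f \<in> Lp_space 1 K \<longleftrightarrow> integrable (lebesgue_on K) f"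
    if "f \<in> borel_measurable (lebesgue_on \<Omega>)" "K \<subseteq> \<Omega>" for K
  proof -
    have "f \<in> borel_measurable (lebesgue_on K)"
      using that measurable_restrict_mono by blast
    then show ?thesis
      by (simp add: Lp_space_def integrable_norm_iff)
  qed
  then show ?thesis by (auto simp: Lp_loc_def)
qed

lemma integrable_mult_compact_support:
  fixes f :: "real^'n \<Rightarrow> 'b::euclidean_space"
  assumes "open \<Omega>" "f \<in> Lp_loc 1 \<Omega>"
    and "continuous_on UNIV \<phi>" "compact (closure {x. \<phi> x \<noteq> 0})" "closure {x. \<phi> x \<noteq> 0} \<subseteq> \<Omega>"
  shows "integrable (lebesgue_on \<Omega>) (\<lambda>x. \<phi> x *\<^sub>R f x)"
proof -
  let ?K = "closure {x. \<phi> x \<noteq> 0}"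
  have K: "?K \<in> sets lebesgue" by simp
  have "integrable (lebesgue_on ?K) f"
    using assms by (simp add: Lp_loc_1_iff)
  then have 1: "integrable lebesgue (\<lambda>x. indicator ?K x *\<^sub>R f x)"
    using K by (subst (asm) integrable_restrict_space) auto
  obtain C where C: "\<And>x. x \<in> ?K \<Longrightarrow> norm (\<phi> x) \<le> C"
    using continuous_bounded_on_compact[OF assms(3,4)] by blast
  have m: "\<phi> \<in> borel_measurable lebesgue"
    using borel_measurable_lebesgue_on_continuous[OF assms(3), of UNIV] by (simp add: lebesgue_on_UNIV_eq)
  have "integrable lebesgue (\<lambda>x. \<phi> x *\<^sub>R (indicator ?K x *\<^sub>R f x))"
  proof (rule Bochner_Integration.integrable_bound[OF integrable_scaleR_right[OF 1, of "\<bar>C\<bar>"]])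
    show "(\<lambda>x. \<phi> x *\<^sub>R (indicator ?K x *\<^sub>R f x)) \<in> borel_measurable lebesgue"
      using m borel_measurable_integrable[OF 1] by measurable
    show "AE x in lebesgue. norm (\<phi> x *\<^sub>R (indicator ?K x *\<^sub>R f x))
        \<le> norm (\<bar>C\<bar> *\<^sub>R (indicator ?K x *\<^sub>R f x))"
      using C by (auto intro!: AE_I2 mult_right_mono simp: indicator_def) (meson abs_ge_self order_trans)
  qed
  moreover have "\<phi> x *\<^sub>R (indicator ?K x *\<^sub>R f x) = indicator \<Omega> x *\<^sub>R (\<phi> x *\<^sub>R f x)" for x
    using in_closure_support[of \<phi> x] assms(5) by (auto simp: indicator_def)
  ultimately have "integrable lebesgue (\<lambda>x. indicator \<Omega> x *\<^sub>R (\<phi> x *\<^sub>R f x))"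
    by (simp only:)
  then show ?thesis
    using assms(1) by (subst integrable_restrict_space) simp_all
qed

lemma integrable_test_scaleR:
  fixes f :: "real^'n \<Rightarrow> 'b::euclidean_space"
  assumes "open \<Omega>" "f \<in> Lp_loc 1 \<Omega>" "\<phi> \<in> test_functions \<Omega>"
  shows "integrable (lebesgue_on \<Omega>) (\<lambda>x. \<phi> x *\<^sub>R f x)"
  using assms test_function_continuous[OF assms(3)]
  by (intro integrable_mult_compact_support) (auto simp: test_functions_def)

lemma integral_lebesgue_on_eq_lebesgue:
  fixes f :: "'a::euclidean_space \<Rightarrow> 'b::{banach, second_countable_topology}"
  assumes "S \<in> sets lebesgue" "\<And>x. x \<notin> S \<Longrightarrow> f x = 0"
  shows "integral\<^sup>L (lebesgue_on S) f = integral\<^sup>L lebesgue f"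
proof -
  have "indicator S x *\<^sub>R f x = f x" for x using assms(2) by (auto simp: indicator_def)
  then show ?thesis using assms(1) by (subst integral_restrict_space) auto
qed

lemma has_real_derivative_along_axis:
  assumes "f differentiable (at (x + s *\<^sub>R axis i 1))"
  shows "((\<lambda>s. f (x + s *\<^sub>R axis i 1)) has_real_derivative partial_deriv i f (x + s *\<^sub>R axis i 1)) (at s)"
proof -
  let ?D = "frechet_derivative f (at (x + s *\<^sub>R axis i 1))"
  have 1: "(f has_derivative ?D) (at (x + s *\<^sub>R axis i 1))"
    using assms by (simp add: frechet_derivative_works)
  have "((\<lambda>s. f (x + s *\<^sub>R axis i 1)) has_derivative (\<lambda>t. ?D (t *\<^sub>R axis i 1))) (at s)"
    by (rule has_derivative_compose[where f="\<lambda>s. x + s *\<^sub>R axis i 1" and g=f and g'="?D", OF _ 1])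
      (auto intro!: derivative_eq_intros)
  moreover have "(\<lambda>t. ?D (t *\<^sub>R axis i 1)) = (*) (partial_deriv i f (x + s *\<^sub>R axis i 1))"
    by (rule ext) (simp add: partial_deriv_def linear_scale[OF has_derivative_linear[OF 1]])
  ultimately show ?thesis
    by (simp only: has_field_derivative_def)
qed

text \<open>
  Each difference quotient of \<open>f\<close> in direction \<open>i\<close> has integral \<open>0\<close> by translation invariance of
  Lebesgue measure. By the mean value theorem the quotients are bounded on a fixed ball outside
  which they vanish, so dominated convergence passes this to the derivative.
\<close>

lemma integral_partial_deriv_eq_0:
  fixes f :: "real^'n \<Rightarrow> real"
  assumes "Ck (Suc 0) f" "compact (closure {x. f x \<noteq> 0})"
  shows "(\<integral>x. partial_deriv i f x \<partial>lebesgue) = 0"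
proof -
  let ?e = "axis i 1 :: real^'n" and ?K = "closure {x. f x \<noteq> 0}" and ?D = "partial_deriv i f"
  have diff: "f differentiable (at x)" for x using assms(1) by simp
  have cont: "continuous_on UNIV f" using Ck_Suc_imp_Ck[OF assms(1)] by simp
  have contD: "continuous_on UNIV ?D" using assms(1) by simp
  have [measurable]: "f \<in> borel_measurable borel" "?D \<in> borel_measurable borel"
    using cont contD by (simp_all add: borel_measurable_continuous_onI)
  obtain R where R: "\<And>x. x \<in> ?K \<Longrightarrow> norm x \<le> R"
    using compact_imp_bounded[OF assms(2)] by (auto simp: bounded_iff)
  let ?B = "cball 0 (R + 1) :: (real^'n) set"
  have out: "f x = 0" if "norm x > R" for x
    using R[of x] in_closure_support[of f x] that by force
  obtain C where C: "\<And>x. x \<in> cball 0 (R + 2) \<Longrightarrow> norm (?D x) \<le> C"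
    using continuous_bounded_on_compact[OF contD compact_cball] by blast
  define q where "q n x = (f (x + inverse (real (Suc n)) *\<^sub>R ?e) - f x) * real (Suc n)" for n x
  have fint: "integrable lborel f"
  proof -
    obtain C' where C': "\<And>x. x \<in> ?B \<Longrightarrow> norm (f x) \<le> C'"
      using continuous_bounded_on_compact[OF cont compact_cball] by blast
    show ?thesis
    proof (rule Bochner_Integration.integrable_bound)
      show "integrable lborel (\<lambda>x. C' * indicator ?B x)"
        by (intro integrable_mult_right integrable_real_indicator) (auto simp: emeasure_lborel_cball_finite[unfolded infinity_ennreal_def])
      show "AE x in lborel. norm (f x) \<le> norm (C' * indicator ?B x)"
        using C' out by (auto intro!: AE_I2 simp: indicator_def) (force simp: not_le)+
    qed auto
  qed
  have q0: "(\<integral>x. q n x \<partial>lborel) = 0" for n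
  proof -
    let ?h = "inverse (real (Suc n)) *\<^sub>R ?e"
    have "integrable lborel (\<lambda>x. f (x + ?h))"
      using integrable_distr[of "(+) ?h" lborel borel f] fint
      unfolding lborel_distr_plus by (simp add: add.commute)
    moreover have "(\<integral>x. f (x + ?h) \<partial>lborel) = (\<integral>x. f x \<partial>lborel)"
      using integral_distr[of "(+) ?h" lborel borel f]
      unfolding lborel_distr_plus by (simp add: add.commute)
    ultimately show ?thesis
      unfolding q_def using fint by simp
  qed
  have lim: "(\<lambda>n. q n x) \<longlonglongrightarrow> ?D x" for x
  proof -
    have "((\<lambda>s. f (x + s *\<^sub>R ?e)) has_real_derivative ?D x) (at 0)"
      using has_real_derivative_along_axis[of f x 0 i] diff by simp
    then have "((\<lambda>h. (f (x + h *\<^sub>R ?e) - f x) / h) \<longlongrightarrow> ?D x) (at 0)"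
      by (simp add: has_field_derivative_iff)
    moreover have "filterlim (\<lambda>n. inverse (real (Suc n))) (at 0) sequentially"
      using LIMSEQ_inverse_real_of_nat by (simp add: filterlim_at)
    ultimately have "(\<lambda>n. (f (x + inverse (real (Suc n)) *\<^sub>R ?e) - f x) / inverse (real (Suc n))) \<longlonglongrightarrow> ?D x"
      by (rule filterlim_compose)
    then show ?thesis by (simp add: q_def field_simps)
  qed
  have bd: "norm (q n x) \<le> \<bar>C\<bar> * indicator ?B x" for n x
  proof -
    let ?h = "inverse (real (Suc n))"
    have h: "0 < ?h" "?h \<le> 1" by (auto simp: inverse_eq_divide)
    have nh: "norm (s *\<^sub>R ?e) \<le> 1" if "0 \<le> s" "s \<le> ?h" for s
      using that h by simp
    show ?thesis
    proof (cases "x \<in> ?B")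
      case True
      obtain s where s: "0 < s" "s < ?h"
        "f (x + ?h *\<^sub>R ?e) - f (x + 0 *\<^sub>R ?e) = (?h - 0) * ?D (x + s *\<^sub>R ?e)"
        using MVT2[OF h(1), of "\<lambda>s. f (x + s *\<^sub>R ?e)" "\<lambda>s. ?D (x + s *\<^sub>R ?e)"]
          has_real_derivative_along_axis diff by blast
      have "q n x = ?D (x + s *\<^sub>R ?e)"
        unfolding q_def using s(3) h by (simp add: field_simps)
      moreover have "x + s *\<^sub>R ?e \<in> cball 0 (R + 2)"
        using True norm_triangle_ineq[of x "s *\<^sub>R ?e"] nh[of s] s by simp
      ultimately show ?thesis using True C[of "x + s *\<^sub>R ?e"] by simp
    next
      case False
      then have "norm x > R + 1" by simp
      moreover have "norm (x + ?h *\<^sub>R ?e) \<ge> norm x - 1"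
        using norm_triangle_ineq2[of x "- (?h *\<^sub>R ?e)"] nh[of ?h] h by simp
      ultimately show ?thesis by (simp add: q_def out)
    qed
  qed
  have "(\<lambda>n. \<integral>x. q n x \<partial>lborel) \<longlonglongrightarrow> (\<integral>x. ?D x \<partial>lborel)"
  proof (rule integral_dominated_convergence[where w="\<lambda>x. \<bar>C\<bar> * indicator ?B x"])
    show "integrable lborel (\<lambda>x. \<bar>C\<bar> * indicator ?B x)"
      by (intro integrable_mult_right integrable_real_indicator) (auto simp: emeasure_lborel_cball_finite[unfolded infinity_ennreal_def])
  qed (use lim bd in \<open>auto simp: q_def\<close>)
  then have "(\<integral>x. ?D x \<partial>lborel) = 0"
    by (simp add: q0 LIMSEQ_const_iff)
  then show ?thesis
    by (subst integral_completion) auto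
qed

lemma Lp_loc_1_if_continuous:
  fixes f :: "real^'n \<Rightarrow> real"
  assumes "continuous_on UNIV f"
  shows "f \<in> Lp_loc 1 \<Omega>"
  unfolding Lp_loc_1_iff
proof (intro conjI allI impI)
  fix K :: "(real^'n) set" assume K: "compact K \<and> K \<subseteq> \<Omega>"
  then have "integrable lborel (\<lambda>x. indicator K x *\<^sub>R f x)"
    using borel_integrable_compact[of K f] continuous_on_subset[OF assms] by auto
  then have "integrable lebesgue (\<lambda>x. indicator K x *\<^sub>R f x)"
    by (subst integrable_completion) (auto intro: borel_measurable_integrable)
  then show "integrable (lebesgue_on K) f"
    using K by (subst integrable_restrict_space) (auto simp: borel_compact)
qed (rule borel_measurable_lebesgue_on_continuous[OF assms])

lemma integral_by_parts_C1:
  fixes f :: "real^'n \<Rightarrow> real"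
  assumes "open \<Omega>" "Ck (Suc 0) f" "\<phi> \<in> test_functions \<Omega>"
  shows "(\<integral>x. f x * partial_deriv i \<phi> x \<partial>lebesgue_on \<Omega>)
    = - (\<integral>x. partial_deriv i f x * \<phi> x \<partial>lebesgue_on \<Omega>)"
proof -
  let ?h = "\<lambda>x. f x * \<phi> x"
  have \<phi>: "Ck (Suc 0) \<phi>" using assms(3) by (rule test_function_Ck)
  have f: "continuous_on UNIV f" "continuous_on UNIV (partial_deriv i f)"
    using Ck_Suc_imp_Ck[OF assms(2)] assms(2) by simp_all
  have h: "Ck (Suc 0) ?h" by (intro Ck_mult assms \<phi>)
  have pd: "partial_deriv i ?h x = f x * partial_deriv i \<phi> x + partial_deriv i f x * \<phi> x" for x
    using assms(2) \<phi> by (intro partial_deriv_mult) auto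
  have sub: "closure {x. ?h x \<noteq> 0} \<subseteq> closure {x. \<phi> x \<noteq> 0}"
    by (rule closure_mono) auto
  have supp: "compact (closure {x. \<phi> x \<noteq> 0})" "closure {x. \<phi> x \<noteq> 0} \<subseteq> \<Omega>"
    using assms(3) by (auto simp: test_functions_def)
  have "compact (closure {x. ?h x \<noteq> 0})"
    by (rule compact_if_closed_subset[OF supp(1) closed_closure sub])
  then have "(\<integral>x. partial_deriv i ?h x \<partial>lebesgue) = 0"
    using integral_partial_deriv_eq_0[OF h] by blast
  moreover have "\<phi> x = 0 \<and> partial_deriv i \<phi> x = 0" if "x \<notin> \<Omega>" for x
    using that in_closure_support[of \<phi> x] in_closure_support[of "partial_deriv i \<phi>" x]
      test_function_partial_deriv[OF assms(3), of i] supp by (auto simp: test_functions_def)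
  then have "(\<integral>x. partial_deriv i ?h x \<partial>lebesgue_on \<Omega>) = (\<integral>x. partial_deriv i ?h x \<partial>lebesgue)"
    using assms(1) by (intro integral_lebesgue_on_eq_lebesgue) (auto simp: pd)
  ultimately have 0: "(\<integral>x. partial_deriv i ?h x \<partial>lebesgue_on \<Omega>) = 0" by simp
  note loc = Lp_loc_1_if_continuous
  have "integrable (lebesgue_on \<Omega>) (\<lambda>x. f x * partial_deriv i \<phi> x)"
    using integrable_test_scaleR[OF assms(1) loc[OF f(1)] test_function_partial_deriv[OF assms(3)]]
    by (simp add: mult.commute)
  moreover have "integrable (lebesgue_on \<Omega>) (\<lambda>x. partial_deriv i f x * \<phi> x)"
    using integrable_test_scaleR[OF assms(1) loc[OF f(2)] assms(3)]
    by (simp add: mult.commute)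
  ultimately show ?thesis
    using 0 unfolding pd by simp
qed

text \<open>
  The bumps \<open>box_bump n a b\<close> are test functions that converge boundedly to the indicator of the box.
\<close>

lemma integral_box_eq_0_if_tested_0:
  fixes g :: "real^'n \<Rightarrow> real"
  assumes "open \<Omega>" "g \<in> Lp_loc 1 \<Omega>"
    and 0: "\<And>\<phi>. \<phi> \<in> test_functions \<Omega> \<Longrightarrow> (\<integral>x. g x * \<phi> x \<partial>lebesgue_on \<Omega>) = 0"
    and sub: "cbox a b \<subseteq> \<Omega>"
  shows "(\<integral>x. indicator (box a b) x * g x \<partial>lebesgue) = 0"
proof -
  let ?\<phi> = "\<lambda>n. box_bump (real (Suc n)) a b"
  have test: "?\<phi> n \<in> test_functions \<Omega>" for n
    using test_function_box_bump[OF sub] by simp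
  have out: "?\<phi> n x = 0" if "x \<notin> cbox a b" for n x
    using box_bump_eq_0[of "real (Suc n)" x a b] that box_subset_cbox by auto
  have "integrable (lebesgue_on (cbox a b)) g"
    using assms by (simp add: Lp_loc_1_iff)
  then have int: "integrable lebesgue (\<lambda>x. indicator (cbox a b) x * g x)"
    by (subst (asm) integrable_restrict_space) auto
  have [measurable]: "?\<phi> n \<in> borel_measurable lebesgue" for n
    using borel_measurable_lebesgue_on_continuous[OF test_function_continuous[OF test], of _ UNIV]
    by (simp add: lebesgue_on_UNIV_eq)
  have m[measurable]: "(\<lambda>x. indicator (cbox a b) x * g x) \<in> borel_measurable lebesgue"
    using int by (rule borel_measurable_integrable)
  have eq1: "indicator (box a b) x * g x = indicator (box a b) x * (indicator (cbox a b) x * g x)" for x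
    using box_subset_cbox[of a b] by (auto simp: indicator_def)
  have eq2: "?\<phi> n x * g x = ?\<phi> n x * (indicator (cbox a b) x * g x)" for n x
    using out[of x n] by (auto simp: indicator_def)
  have "(\<lambda>n. \<integral>x. ?\<phi> n x * g x \<partial>lebesgue) \<longlonglongrightarrow> (\<integral>x. indicator (box a b) x * g x \<partial>lebesgue)"
  proof (rule integral_dominated_convergence[where w="\<lambda>x. norm (indicator (cbox a b) x * g x)"])
    show "(\<lambda>x. indicator (box a b) x * g x) \<in> borel_measurable lebesgue"
      unfolding eq1 by (intro borel_measurable_times borel_measurable_indicator m) simp
    show "(\<lambda>x. ?\<phi> n x * g x) \<in> borel_measurable lebesgue" for n
      unfolding eq2 by measurable
    show "AE x in lebesgue. (\<lambda>n. ?\<phi> n x * g x) \<longlonglongrightarrow> indicator (box a b) x * g x"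
      by (intro AE_I2 tendsto_mult box_bump_tendsto tendsto_const)
    show "AE x in lebesgue. norm (?\<phi> n x * g x) \<le> norm (indicator (cbox a b) x * g x)" for n
      unfolding eq2 using box_bump_le_1[of "real (Suc n)" a b]
      by (auto simp: abs_mult intro!: AE_I2 mult_left_le_one_le)
  qed (use int in auto)
  moreover have "(\<integral>x. ?\<phi> n x * g x \<partial>lebesgue) = 0" for n
    using 0[OF test, of n] out sub assms(1)
    by (subst (asm) integral_lebesgue_on_eq_lebesgue) (auto simp: mult.commute)
  ultimately show ?thesis by (simp add: LIMSEQ_const_iff)
qed

text \<open>
  The fundamental lemma of the calculus of variations. All box integrals of \<open>g\<close> inside \<open>\<Omega>\<close> vanish, and
  by Lebesgue's differentiation theorem over shrinking cubes \<open>g\<close> is almost everywhere the limit of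
  averages of this kind; countably many closed boxes exhaust \<open>\<Omega>\<close>.
\<close>

lemma fundamental_lemma:
  fixes g :: "real^'n \<Rightarrow> real"
  assumes "open \<Omega>" "g \<in> Lp_loc 1 \<Omega>"
    and 0: "\<And>\<phi>. \<phi> \<in> test_functions \<Omega> \<Longrightarrow> (\<integral>x. g x * \<phi> x \<partial>lebesgue_on \<Omega>) = 0"
  shows "AE x in lebesgue_on \<Omega>. g x = 0"
proof -
  have cb: "AE x in lebesgue. x \<in> cbox c d \<longrightarrow> g x = 0" if sub: "cbox c d \<subseteq> \<Omega>" for c d
  proof -
    define f where "f = (\<lambda>x. indicator (cbox c d) x * g x)"
    have "integrable (lebesgue_on (cbox c d)) g"
      using assms sub by (simp add: Lp_loc_1_iff)
    then have int: "integrable lebesgue f"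
      unfolding f_def by (subst (asm) integrable_restrict_space) auto
    have int': "integrable (lebesgue_on (cbox a b)) f" for a b
      using integrable_mult_indicator[OF _ int, of "cbox a b"]
      by (subst integrable_restrict_space) auto
    have zero: "integral (cbox a b) f = 0" for a b
    proof -
      obtain p q where pq: "cbox a b \<inter> cbox c d = cbox p q"
        using Int_interval[of a b c d] by (rule that)
      have "AE x in lebesgue. x \<notin> cbox p q - box p q"
        by (rule AE_not_in) (simp add: negligible_frontier_interval flip: negligible_iff_null_sets)
      then have ae: "AE x in lebesgue. indicator (cbox a b) x *\<^sub>R f x = indicator (box p q) x * g x"
        by eventually_elim (use pq box_subset_cbox[of p q] in \<open>auto simp: f_def indicator_def\<close>)
      have "integral (cbox a b) f = (\<integral>x. f x \<partial>lebesgue_on (cbox a b))"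
        by (rule lebesgue_integral_eq_integral[symmetric]) (use int' in auto)
      also have "\<dots> = (\<integral>x. indicator (cbox a b) x *\<^sub>R f x \<partial>lebesgue)"
        by (subst integral_restrict_space) auto
      also have "\<dots> = (\<integral>x. indicator (box p q) x * g x \<partial>lebesgue)"
      proof (rule integral_cong_AE[OF _ _ ae])
        have fm: "f \<in> borel_measurable lebesgue"
          using int by (rule borel_measurable_integrable)
        show "(\<lambda>x. indicator (cbox a b) x *\<^sub>R f x) \<in> borel_measurable lebesgue"
          by (intro borel_measurable_scaleR borel_measurable_indicator fm) simp
        have "indicator (box p q) x * g x = indicator (box p q) x * f x" for x
          using pq box_subset_cbox[of p q] by (auto simp: f_def indicator_def)
        then show "(\<lambda>x. indicator (box p q) x * g x) \<in> borel_measurable lebesgue"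
          by (simp only:) (intro borel_measurable_times borel_measurable_indicator fm, simp)
      qed
      also have "\<dots> = 0"
        using integral_box_eq_0_if_tested_0[OF assms(1,2) 0] pq sub by blast
      finally show ?thesis .
    qed
    have "f integrable_on cbox a b" for a b
      by (rule integrable_on_lebesgue_on[OF int']) simp
    from integrable_ccontinuous_explicit[OF this] obtain N where N: "negligible N"
      "\<And>x e. \<lbrakk>x \<notin> N; 0 < e\<rbrakk> \<Longrightarrow> \<exists>d>0. \<forall>h. 0 < h \<and> h < d \<longrightarrow>
         norm (integral (cbox x (x + h *\<^sub>R One)) f /\<^sub>R h ^ DIM(real^'n) - f x) < e"
      by metis
    have "f x = 0" if xN: "x \<notin> N" for x
    proof (rule ccontr)
      assume "f x \<noteq> 0"
      then have "\<exists>d>0. \<forall>h>0. \<not> h < (d::real)"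
        using N(2)[OF xN, of "norm (f x)"] zero by simp
      then show False using dense[of "0::real"] by blast
    qed
    moreover have "AE x in lebesgue. x \<notin> N"
      using N(1) by (intro AE_not_in) (simp flip: negligible_iff_null_sets)
    ultimately show ?thesis
      by (auto elim!: eventually_mono simp: f_def) (metis indicator_simps(1) zero_neq_one)
  qed
  obtain \<D> where D: "countable \<D>" "\<D> \<subseteq> Pow \<Omega>" "\<And>X. X \<in> \<D> \<Longrightarrow> \<exists>a b. X = cbox a b" "\<Union>\<D> = \<Omega>"
    by (rule open_countable_Union_open_cbox[OF assms(1)]) (rule that)
  have "AE x in lebesgue. x \<in> X \<longrightarrow> g x = 0" if "X \<in> \<D>" for X
    using D(3)[OF that] D(2) that cb by blast
  then have "AE x in lebesgue. \<forall>X\<in>\<D>. x \<in> X \<longrightarrow> g x = 0"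
    unfolding AE_ball_countable[OF D(1)] by (rule ballI)
  then have "AE x in lebesgue. x \<in> \<Omega> \<longrightarrow> g x = 0"
    by eventually_elim (use D(4) in blast)
  then show ?thesis
    using assms(1) by (subst AE_restrict_space_iff) auto
qed

section \<open>Square integrable functions\<close>

lemma Lp_space_2_iff:
  "f \<in> Lp_space 2 \<Omega> \<longleftrightarrow> f \<in> borel_measurable (lebesgue_on \<Omega>) \<and>
     integrable (lebesgue_on \<Omega>) (\<lambda>x. (norm (f x))\<^sup>2)"
  by (simp add: Lp_space_def numeral_eq_ereal)

lemma Lp_norm_2_power2: "(Lp_norm 2 \<Omega> f)\<^sup>2 = (\<integral>x. (norm (f x))\<^sup>2 \<partial>lebesgue_on \<Omega>)"
  by (simp add: Lp_norm_def numeral_eq_ereal powr_half_sqrt)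

lemma Lp_space_2_measurable: "f \<in> Lp_space 2 \<Omega> \<Longrightarrow> f \<in> borel_measurable (lebesgue_on \<Omega>)"
  unfolding Lp_space_2_iff by (rule conjunct1)

lemma Lp_space_2_integrable: "f \<in> Lp_space 2 \<Omega> \<Longrightarrow> integrable (lebesgue_on \<Omega>) (\<lambda>x. (norm (f x))\<^sup>2)"
  unfolding Lp_space_2_iff by (rule conjunct2)

lemma Lp_space_2_if_norm_power2_le:
  assumes "g \<in> borel_measurable (lebesgue_on \<Omega>)" "integrable (lebesgue_on \<Omega>) F"
    and "AE x in lebesgue_on \<Omega>. (norm (g x))\<^sup>2 \<le> F x"
  shows "g \<in> Lp_space 2 \<Omega>"
  unfolding Lp_space_2_iff
proof
  show "integrable (lebesgue_on \<Omega>) (\<lambda>x. (norm (g x))\<^sup>2)"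
  proof (rule Bochner_Integration.integrable_bound[OF assms(2)])
    show "(\<lambda>x. (norm (g x))\<^sup>2) \<in> borel_measurable (lebesgue_on \<Omega>)"
      using assms(1) by measurable
    show "AE x in lebesgue_on \<Omega>. norm ((norm (g x))\<^sup>2) \<le> norm (F x)"
      using assms(3) by eventually_elim simp
  qed
qed (rule assms(1))

lemma power2_add_le: "(a + b)\<^sup>2 \<le> 2 * a\<^sup>2 + 2 * b\<^sup>2" for a b :: real
  using sum_squares_bound[of a b] by (simp add: power2_sum)

lemma norm_add_power2_le: "(norm (a + b))\<^sup>2 \<le> 2 * (norm a)\<^sup>2 + 2 * (norm b)\<^sup>2"
  using power_mono[OF norm_triangle_ineq norm_ge_zero, of a b 2] power2_add_le[of "norm a" "norm b"]
  by linarith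

lemma Lp_space_2_add:
  assumes "f \<in> Lp_space 2 \<Omega>" "g \<in> Lp_space 2 \<Omega>"
  shows "(\<lambda>x. f x + g x) \<in> Lp_space 2 \<Omega>"
proof (rule Lp_space_2_if_norm_power2_le)
  show "integrable (lebesgue_on \<Omega>) (\<lambda>x. 2 * (norm (f x))\<^sup>2 + 2 * (norm (g x))\<^sup>2)"
    using assms[THEN Lp_space_2_integrable] by simp
  show "(\<lambda>x. f x + g x) \<in> borel_measurable (lebesgue_on \<Omega>)"
    using assms[THEN Lp_space_2_measurable] by measurable
qed (intro AE_I2 norm_add_power2_le)

lemma Lp_space_2_dominated:
  fixes f :: "real^'n \<Rightarrow> 'b::euclidean_space" and g :: "real^'n \<Rightarrow> 'c::euclidean_space"
  assumes "f \<in> Lp_space 2 \<Omega>" "g \<in> borel_measurable (lebesgue_on \<Omega>)"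
    and "AE x in lebesgue_on \<Omega>. norm (g x) \<le> C * norm (f x)"
  shows "g \<in> Lp_space 2 \<Omega>"
proof (rule Lp_space_2_if_norm_power2_le[OF assms(2)])
  show "integrable (lebesgue_on \<Omega>) (\<lambda>x. C\<^sup>2 * (norm (f x))\<^sup>2)"
    using Lp_space_2_integrable[OF assms(1)] by simp
  show "AE x in lebesgue_on \<Omega>. (norm (g x))\<^sup>2 \<le> C\<^sup>2 * (norm (f x))\<^sup>2"
    using assms(3) by eventually_elim (metis norm_ge_zero power_mono power_mult_distrib)
qed

lemma Lp_space_2_scaleR:
  assumes "f \<in> Lp_space 2 \<Omega>" "b \<in> borel_measurable (lebesgue_on \<Omega>)"
    and "AE x in lebesgue_on \<Omega>. \<bar>b x\<bar> \<le> C"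
  shows "(\<lambda>x. b x *\<^sub>R f x) \<in> Lp_space 2 \<Omega>"
proof (rule Lp_space_2_dominated[OF assms(1)])
  show "(\<lambda>x. b x *\<^sub>R f x) \<in> borel_measurable (lebesgue_on \<Omega>)"
    using assms(2) Lp_space_2_measurable[OF assms(1)] by measurable
  show "AE x in lebesgue_on \<Omega>. norm (b x *\<^sub>R f x) \<le> C * norm (f x)"
    using assms(3) by eventually_elim (simp add: mult_right_mono)
qed

lemma Lp_space_2_diff:
  assumes "f \<in> Lp_space 2 \<Omega>" "g \<in> Lp_space 2 \<Omega>"
  shows "(\<lambda>x. f x - g x) \<in> Lp_space 2 \<Omega>"
  using Lp_space_2_add[OF assms(1) Lp_space_2_scaleR[OF assms(2), of "\<lambda>_. -1" 1]] by simp

lemma integrable_norm_mult_norm: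
  assumes "f \<in> Lp_space 2 \<Omega>" "g \<in> Lp_space 2 \<Omega>"
  shows "integrable (lebesgue_on \<Omega>) (\<lambda>x. norm (f x) * norm (g x))"
proof (rule Bochner_Integration.integrable_bound)
  show "integrable (lebesgue_on \<Omega>) (\<lambda>x. (norm (f x))\<^sup>2 + (norm (g x))\<^sup>2)"
    using assms[THEN Lp_space_2_integrable] by simp
  show "(\<lambda>x. norm (f x) * norm (g x)) \<in> borel_measurable (lebesgue_on \<Omega>)"
    using assms[THEN Lp_space_2_measurable] by measurable
  show "AE x in lebesgue_on \<Omega>. norm (norm (f x) * norm (g x)) \<le> norm ((norm (f x))\<^sup>2 + (norm (g x))\<^sup>2)"
  proof (rule AE_I2)
    fix x
    show "norm (norm (f x) * norm (g x)) \<le> norm ((norm (f x))\<^sup>2 + (norm (g x))\<^sup>2)"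
      using sum_squares_bound[of "norm (f x)" "norm (g x)"] mult_nonneg_nonneg[of "norm (f x)" "norm (g x)"]
      by (simp del: mult_nonneg_nonneg)
  qed
qed

lemma integrable_inner_Lp_space_2:
  fixes f g :: "real^'n \<Rightarrow> 'b::euclidean_space"
  assumes "f \<in> Lp_space 2 \<Omega>" "g \<in> Lp_space 2 \<Omega>"
  shows "integrable (lebesgue_on \<Omega>) (\<lambda>x. f x \<bullet> g x)"
proof (rule Bochner_Integration.integrable_bound[OF integrable_norm_mult_norm[OF assms]])
  show "(\<lambda>x. f x \<bullet> g x) \<in> borel_measurable (lebesgue_on \<Omega>)"
    using assms[THEN Lp_space_2_measurable] by measurable
  show "AE x in lebesgue_on \<Omega>. norm (f x \<bullet> g x) \<le> norm (norm (f x) * norm (g x))"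
    by (rule AE_I2) (simp add: Cauchy_Schwarz_ineq2)
qed

lemma finite_measure_lebesgue_on_open:
  "open \<Omega> \<Longrightarrow> bounded \<Omega> \<Longrightarrow> finite_measure (lebesgue_on \<Omega>)"
  for \<Omega> :: "'a::euclidean_space set"
  by (intro finite_measure_lebesgue_on bounded_set_imp_lmeasurable sets_lebesgue_open)

lemma integrable_if_Lp_space_2:
  assumes "finite_measure (lebesgue_on \<Omega>)" "f \<in> Lp_space 2 \<Omega>"
  shows "integrable (lebesgue_on \<Omega>) f"
proof (rule Bochner_Integration.integrable_bound)
  interpret finite_measure "lebesgue_on \<Omega>" by fact
  show "integrable (lebesgue_on \<Omega>) (\<lambda>x. 1 + (norm (f x))\<^sup>2)"
    using Lp_space_2_integrable[OF assms(2)] by simp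
  show "AE x in lebesgue_on \<Omega>. norm (f x) \<le> norm (1 + (norm (f x))\<^sup>2)"
  proof (rule AE_I2)
    fix x
    show "norm (f x) \<le> norm (1 + (norm (f x))\<^sup>2)"
      using sum_squares_bound[of 1 "norm (f x)"] norm_ge_zero[of "f x"] by (simp del: norm_ge_zero)
  qed
qed (rule Lp_space_2_measurable[OF assms(2)])

lemma Lp_loc_1_if_integrable:
  fixes f :: "real^'n \<Rightarrow> 'b::euclidean_space"
  assumes "open \<Omega>" "integrable (lebesgue_on \<Omega>) f"
  shows "f \<in> Lp_loc 1 \<Omega>"
  unfolding Lp_loc_1_iff
proof (intro conjI allI impI)
  fix K assume K: "compact K \<and> K \<subseteq> \<Omega>"
  have "integrable lebesgue (\<lambda>x. indicator \<Omega> x *\<^sub>R f x)"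
    using assms(2,1) by (subst (asm) integrable_restrict_space) auto
  from integrable_mult_indicator[OF _ this, of K]
  have "integrable lebesgue (\<lambda>x. indicator K x *\<^sub>R (indicator \<Omega> x *\<^sub>R f x))"
    using K by (simp add: borel_compact)
  moreover have "indicator K x *\<^sub>R (indicator \<Omega> x *\<^sub>R f x) = indicator K x *\<^sub>R f x" for x
    using K by (auto simp: indicator_def)
  ultimately have "integrable lebesgue (\<lambda>x. indicator K x *\<^sub>R f x)"
    by (simp only:)
  then show "integrable (lebesgue_on K) f"
    using K by (subst integrable_restrict_space) (auto simp: borel_compact)
qed (use assms in auto)

lemma Lp_loc_1_scaleR:
  fixes f :: "real^'n \<Rightarrow> 'b::euclidean_space"
  assumes "f \<in> Lp_loc 1 \<Omega>" "b \<in> borel_measurable (lebesgue_on \<Omega>)" "\<And>x. \<bar>b x\<bar> \<le> C"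
  shows "(\<lambda>x. b x *\<^sub>R f x) \<in> Lp_loc 1 \<Omega>"
  unfolding Lp_loc_1_iff
proof (intro conjI allI impI)
  show "(\<lambda>x. b x *\<^sub>R f x) \<in> borel_measurable (lebesgue_on \<Omega>)"
    using assms(1,2) unfolding Lp_loc_1_iff by (blast intro: borel_measurable_scaleR)
  fix K assume K: "compact K \<and> K \<subseteq> \<Omega>"
  then have f: "integrable (lebesgue_on K) f" using assms(1) by (simp add: Lp_loc_1_iff)
  have b: "b \<in> borel_measurable (lebesgue_on K)"
    using measurable_restrict_mono[OF assms(2)] K by blast
  show "integrable (lebesgue_on K) (\<lambda>x. b x *\<^sub>R f x)"
  proof (rule Bochner_Integration.integrable_bound[OF integrable_scaleR_right[OF f, of C]])
    show "(\<lambda>x. b x *\<^sub>R f x) \<in> borel_measurable (lebesgue_on K)"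
      using b borel_measurable_integrable[OF f] by measurable
    show "AE x in lebesgue_on K. norm (b x *\<^sub>R f x) \<le> norm (C *\<^sub>R f x)"
      using assms(3) by (auto intro!: AE_I2 mult_right_mono) (meson abs_ge_self order_trans)
  qed
qed

lemma Lp_loc_1_add:
  fixes f g :: "real^'n \<Rightarrow> 'b::euclidean_space"
  shows "f \<in> Lp_loc 1 \<Omega> \<Longrightarrow> g \<in> Lp_loc 1 \<Omega> \<Longrightarrow> (\<lambda>x. f x + g x) \<in> Lp_loc 1 \<Omega>"
  by (auto simp: Lp_loc_1_iff)

lemma Lp_loc_1_diff:
  fixes f g :: "real^'n \<Rightarrow> 'b::euclidean_space"
  shows "f \<in> Lp_loc 1 \<Omega> \<Longrightarrow> g \<in> Lp_loc 1 \<Omega> \<Longrightarrow> (\<lambda>x. f x - g x) \<in> Lp_loc 1 \<Omega>"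
  by (auto simp: Lp_loc_1_iff)

lemma Lp_loc_1_nth:
  fixes f :: "real^'n \<Rightarrow> real^'m"
  assumes "f \<in> Lp_loc 1 \<Omega>"
  shows "(\<lambda>x. f x $ i) \<in> Lp_loc 1 \<Omega>"
  using assms unfolding Lp_loc_1_iff cart_eq_inner_axis by auto

lemma test_function_measurable:
  "\<phi> \<in> test_functions \<Omega> \<Longrightarrow> \<phi> \<in> borel_measurable (lebesgue_on S)"
  by (rule borel_measurable_lebesgue_on_continuous[OF test_function_continuous])

lemma test_function_bounded:
  assumes "\<phi> \<in> test_functions \<Omega>"
  obtains C where "\<And>x. \<bar>\<phi> x\<bar> \<le> C"
proof -
  obtain C where C: "\<And>x. x \<in> closure {x. \<phi> x \<noteq> 0} \<Longrightarrow> norm (\<phi> x) \<le> C"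
    using assms continuous_bounded_on_compact[OF test_function_continuous[OF assms],
        of "closure {x. \<phi> x \<noteq> 0}"] unfolding test_functions_def by blast
  have "\<bar>\<phi> x\<bar> \<le> max C 0" for x
    using C[of x] in_closure_support[of \<phi> x] by (cases "\<phi> x = 0") auto
  then show ?thesis by (rule that)
qed

lemma classical_grad_nth [simp]: "classical_grad \<phi> x $ i = partial_deriv i \<phi> x"
  by (simp add: classical_grad_def)

lemma classical_grad_measurable:
  assumes "\<phi> \<in> test_functions \<Omega>"
  shows "classical_grad \<phi> \<in> borel_measurable (lebesgue_on S)"
proof (rule borel_measurable_lebesgue_on_continuous)
  show "continuous_on UNIV (classical_grad \<phi>)"
    unfolding classical_grad_def
    using test_function_continuous[OF test_function_partial_deriv[OF assms]]
    by (intro continuous_intros)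
qed

lemma classical_grad_bounded:
  fixes \<phi> :: "real^'n \<Rightarrow> real"
  assumes "\<phi> \<in> test_functions \<Omega>"
  obtains C where "\<And>x. norm (classical_grad \<phi> x) \<le> C"
proof -
  have "\<exists>C. \<forall>x. \<bar>partial_deriv i \<phi> x\<bar> \<le> C" for i
    using test_function_bounded[OF test_function_partial_deriv[OF assms]] by blast
  then obtain C where C: "\<And>i x. \<bar>partial_deriv i \<phi> x\<bar> \<le> C i"
    by metis
  have "norm (classical_grad \<phi> x) \<le> sum C UNIV" for x
    using norm_le_l1_cart[of "classical_grad \<phi> x"] sum_mono[of UNIV "\<lambda>i. \<bar>partial_deriv i \<phi> x\<bar>" C] C
    by simp
  then show ?thesis by (rule that)
qed

lemma Lp_space_2_if_bounded:
  assumes "finite_measure (lebesgue_on \<Omega>)" "f \<in> borel_measurable (lebesgue_on \<Omega>)"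
    and "AE x in lebesgue_on \<Omega>. norm (f x) \<le> C"
  shows "f \<in> Lp_space 2 \<Omega>"
proof (rule Lp_space_2_if_norm_power2_le[OF assms(2)])
  interpret finite_measure "lebesgue_on \<Omega>" by fact
  show "integrable (lebesgue_on \<Omega>) (\<lambda>_. C\<^sup>2)" by simp
  show "AE x in lebesgue_on \<Omega>. (norm (f x))\<^sup>2 \<le> C\<^sup>2"
    using assms(3) by eventually_elim (simp add: power_mono)
qed

lemma test_function_Lp_space_2:
  assumes "finite_measure (lebesgue_on \<Omega>)" "\<phi> \<in> test_functions \<Omega>"
  shows "\<phi> \<in> Lp_space 2 \<Omega>" "classical_grad \<phi> \<in> Lp_space 2 \<Omega>"
proof -
  obtain C where C: "\<And>x. \<bar>\<phi> x\<bar> \<le> C"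
    using test_function_bounded[OF assms(2)] by blast
  obtain C' where C': "\<And>x. norm (classical_grad \<phi> x) \<le> C'"
    using classical_grad_bounded[OF assms(2)] by blast
  show "\<phi> \<in> Lp_space 2 \<Omega>"
    by (rule Lp_space_2_if_bounded[OF assms(1) test_function_measurable[OF assms(2)]]) (use C in auto)
  show "classical_grad \<phi> \<in> Lp_space 2 \<Omega>"
    by (rule Lp_space_2_if_bounded[OF assms(1) classical_grad_measurable[OF assms(2)]]) (use C' in auto)
qed

section \<open>Weak gradients\<close>

lemma has_weak_gradientD:
  assumes "has_weak_gradient \<Omega> u g"
  shows "u \<in> Lp_loc 1 \<Omega>" "g \<in> Lp_loc 1 \<Omega>"
    and "\<phi> \<in> test_functions \<Omega> \<Longrightarrow>
      (\<integral>x. u x * partial_deriv i \<phi> x \<partial>lebesgue_on \<Omega>) = - (\<integral>x. g x $ i * \<phi> x \<partial>lebesgue_on \<Omega>)"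
  using assms unfolding has_weak_gradient_def by blast+

lemma has_weak_gradient_integrable:
  assumes "open \<Omega>" "has_weak_gradient \<Omega> u g" "\<phi> \<in> test_functions \<Omega>"
  shows "integrable (lebesgue_on \<Omega>) (\<lambda>x. u x * partial_deriv i \<phi> x)"
    and "integrable (lebesgue_on \<Omega>) (\<lambda>x. g x $ i * \<phi> x)"
  using integrable_test_scaleR[OF assms(1) has_weak_gradientD(1)[OF assms(2)]
      test_function_partial_deriv[OF assms(3)], of i]
    integrable_test_scaleR[OF assms(1) Lp_loc_1_nth[OF has_weak_gradientD(2)[OF assms(2)]] assms(3), of i]
  by (simp_all add: mult.commute)

lemma has_weak_gradient_unique:
  fixes g h :: "real^'n \<Rightarrow> real^'n"
  assumes "open \<Omega>" "has_weak_gradient \<Omega> u g" "has_weak_gradient \<Omega> u h"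
  shows "AE x in lebesgue_on \<Omega>. g x = h x"
proof -
  have "AE x in lebesgue_on \<Omega>. g x $ i - h x $ i = 0" for i
  proof (rule fundamental_lemma[OF assms(1)])
    show "(\<lambda>x. g x $ i - h x $ i) \<in> Lp_loc 1 \<Omega>"
      using assms(2,3)[THEN has_weak_gradientD(2)] by (intro Lp_loc_1_diff Lp_loc_1_nth)
    fix \<phi> assume \<phi>: "\<phi> \<in> test_functions \<Omega>"
    show "(\<integral>x. (g x $ i - h x $ i) * \<phi> x \<partial>lebesgue_on \<Omega>) = 0"
      using has_weak_gradient_integrable(2)[OF assms(1,2) \<phi>, of i]
        has_weak_gradient_integrable(2)[OF assms(1,3) \<phi>, of i]
        has_weak_gradientD(3)[OF assms(2) \<phi>, of i] has_weak_gradientD(3)[OF assms(3) \<phi>, of i]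
      by (simp add: left_diff_distrib)
  qed
  then have "AE x in lebesgue_on \<Omega>. \<forall>i\<in>UNIV. g x $ i - h x $ i = 0"
    by (intro AE_finite_allI) auto
  then show ?thesis
    by eventually_elim (simp add: vec_eq_iff)
qed

lemma has_weak_gradient_weak_grad:
  "has_weak_gradient \<Omega> u g \<Longrightarrow> has_weak_gradient \<Omega> u (weak_grad \<Omega> u)"
  unfolding weak_grad_def by (rule someI[of "has_weak_gradient \<Omega> u"])

lemma weak_grad_eq_AE:
  "open \<Omega> \<Longrightarrow> has_weak_gradient \<Omega> u g \<Longrightarrow> AE x in lebesgue_on \<Omega>. weak_grad \<Omega> u x = g x"
  by (rule has_weak_gradient_unique[OF _ has_weak_gradient_weak_grad])

lemma weak_grad_measurable:
  "has_weak_gradient \<Omega> u g \<Longrightarrow> weak_grad \<Omega> u \<in> borel_measurable (lebesgue_on \<Omega>)"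
  using has_weak_gradientD(2)[OF has_weak_gradient_weak_grad] Lp_loc_1_iff by blast

lemma has_weak_gradient_diff:
  assumes "open \<Omega>" "has_weak_gradient \<Omega> u g" "has_weak_gradient \<Omega> v h"
  shows "has_weak_gradient \<Omega> (\<lambda>x. u x - v x) (\<lambda>x. g x - h x)"
  unfolding has_weak_gradient_def
proof (intro conjI ballI allI)
  show "(\<lambda>x. u x - v x) \<in> Lp_loc 1 \<Omega>" "(\<lambda>x. g x - h x) \<in> Lp_loc 1 \<Omega>"
    using has_weak_gradientD(1,2)[OF assms(2)] has_weak_gradientD(1,2)[OF assms(3)]
    by (auto intro: Lp_loc_1_diff)
  fix \<phi> i assume \<phi>: "\<phi> \<in> test_functions \<Omega>"
  show "(\<integral>x. (u x - v x) * partial_deriv i \<phi> x \<partial>lebesgue_on \<Omega>)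
      = - (\<integral>x. (g x - h x) $ i * \<phi> x \<partial>lebesgue_on \<Omega>)"
    using has_weak_gradient_integrable[OF assms(1,2) \<phi>, of i]
      has_weak_gradient_integrable[OF assms(1,3) \<phi>, of i]
      has_weak_gradientD(3)[OF assms(2) \<phi>, of i] has_weak_gradientD(3)[OF assms(3) \<phi>, of i]
    by (simp add: left_diff_distrib)
qed

lemma has_weak_gradient_test_function:
  assumes "open \<Omega>" "bounded \<Omega>" "\<phi> \<in> test_functions \<Omega>"
  shows "has_weak_gradient \<Omega> \<phi> (classical_grad \<phi>)"
  unfolding has_weak_gradient_def
proof (intro conjI ballI allI)
  note fin = finite_measure_lebesgue_on_open[OF assms(1,2)]
  show "\<phi> \<in> Lp_loc 1 \<Omega>" "classical_grad \<phi> \<in> Lp_loc 1 \<Omega>"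
    by (intro Lp_loc_1_if_integrable integrable_if_Lp_space_2 fin test_function_Lp_space_2[OF fin] assms)+
  fix \<psi> i assume "\<psi> \<in> test_functions \<Omega>"
  then show "(\<integral>x. \<phi> x * partial_deriv i \<psi> x \<partial>lebesgue_on \<Omega>)
      = - (\<integral>x. classical_grad \<phi> x $ i * \<psi> x \<partial>lebesgue_on \<Omega>)"
    using integral_by_parts_C1[OF assms(1) test_function_Ck[OF assms(3)]] by simp
qed

text \<open>
  The product rule with one smooth factor \<open>\<phi>\<close> needs no approximation: apply the definition of the weak
  gradient of \<open>u\<close> to the test function \<open>\<phi> \<psi>\<close>.
\<close>

lemma has_weak_gradient_test_function_mult:
  assumes "open \<Omega>" "\<phi> \<in> test_functions \<Omega>" "has_weak_gradient \<Omega> u g"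
  shows "has_weak_gradient \<Omega> (\<lambda>x. \<phi> x * u x) (\<lambda>x. \<phi> x *\<^sub>R g x + u x *\<^sub>R classical_grad \<phi> x)"
  unfolding has_weak_gradient_def
proof (intro conjI ballI allI)
  obtain C where C: "\<And>x. \<bar>\<phi> x\<bar> \<le> C"
    using test_function_bounded[OF assms(2)] by blast
  obtain C' where C': "\<And>x. norm (classical_grad \<phi> x) \<le> C'"
    using classical_grad_bounded[OF assms(2)] by blast
  note u = has_weak_gradientD(1)[OF assms(3)] and g = has_weak_gradientD(2)[OF assms(3)]
  note \<phi>_meas = test_function_measurable[OF assms(2)]
  show "(\<lambda>x. \<phi> x * u x) \<in> Lp_loc 1 \<Omega>"
    using Lp_loc_1_scaleR[OF u \<phi>_meas C] by simp
  have "(\<lambda>x. u x *\<^sub>R classical_grad \<phi> x) \<in> Lp_loc 1 \<Omega>"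
    unfolding Lp_loc_1_iff
  proof (intro conjI allI impI)
    show "(\<lambda>x. u x *\<^sub>R classical_grad \<phi> x) \<in> borel_measurable (lebesgue_on \<Omega>)"
      using u classical_grad_measurable[OF assms(2)] unfolding Lp_loc_1_iff
      by (blast intro: borel_measurable_scaleR)
    fix K assume K: "compact K \<and> K \<subseteq> \<Omega>"
    then have u': "integrable (lebesgue_on K) u" using u by (simp add: Lp_loc_1_iff)
    show "integrable (lebesgue_on K) (\<lambda>x. u x *\<^sub>R classical_grad \<phi> x)"
    proof (rule Bochner_Integration.integrable_bound[OF integrable_mult_right[OF u', of C']])
      show "(\<lambda>x. u x *\<^sub>R classical_grad \<phi> x) \<in> borel_measurable (lebesgue_on K)"
        using borel_measurable_integrable[OF u'] classical_grad_measurable[OF assms(2)] by measurable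
      show "AE x in lebesgue_on K. norm (u x *\<^sub>R classical_grad \<phi> x) \<le> norm (C' * u x)"
        using C' by (auto intro!: AE_I2 mult_right_mono simp: abs_mult mult.commute[of _ "\<bar>u _\<bar>"])
          (meson abs_ge_self mult_left_mono abs_ge_zero order_trans)
    qed
  qed
  moreover have "(\<lambda>x. \<phi> x *\<^sub>R g x) \<in> Lp_loc 1 \<Omega>"
    by (rule Lp_loc_1_scaleR[OF g \<phi>_meas C])
  ultimately show "(\<lambda>x. \<phi> x *\<^sub>R g x + u x *\<^sub>R classical_grad \<phi> x) \<in> Lp_loc 1 \<Omega>"
    by (intro Lp_loc_1_add)
  fix \<psi> i assume \<psi>: "\<psi> \<in> test_functions \<Omega>"
  have \<phi>\<psi>: "(\<lambda>x. \<phi> x * \<psi> x) \<in> test_functions \<Omega>"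
    by (rule test_function_mult[OF assms(2) test_function_Ck[OF \<psi>]])
  have pd: "partial_deriv i (\<lambda>x. \<phi> x * \<psi> x) x = \<phi> x * partial_deriv i \<psi> x + partial_deriv i \<phi> x * \<psi> x" for x
    by (intro partial_deriv_mult test_function_differentiable[OF assms(2)] test_function_differentiable[OF \<psi>])
  have i1: "integrable (lebesgue_on \<Omega>) (\<lambda>x. \<phi> x * u x * partial_deriv i \<psi> x)"
    using integrable_test_scaleR[OF assms(1) u test_function_mult[OF assms(2)
          test_function_Ck[OF test_function_partial_deriv[OF \<psi>, of i]]]]
    by (simp add: mult_ac)
  have i2: "integrable (lebesgue_on \<Omega>) (\<lambda>x. u x * partial_deriv i \<phi> x * \<psi> x)"
    using integrable_test_scaleR[OF assms(1) u test_function_mult[OF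
          test_function_partial_deriv[OF assms(2), of i] test_function_Ck[OF \<psi>]]]
    by (simp add: mult_ac)
  have i3: "integrable (lebesgue_on \<Omega>) (\<lambda>x. \<phi> x * g x $ i * \<psi> x)"
    using has_weak_gradient_integrable(2)[OF assms(1,3) \<phi>\<psi>, of i] by (simp add: mult_ac)
  have "(\<integral>x. u x * partial_deriv i (\<lambda>x. \<phi> x * \<psi> x) x \<partial>lebesgue_on \<Omega>)
      = (\<integral>x. \<phi> x * u x * partial_deriv i \<psi> x + u x * partial_deriv i \<phi> x * \<psi> x \<partial>lebesgue_on \<Omega>)"
    unfolding pd by (simp add: algebra_simps)
  also have "\<dots> = (\<integral>x. \<phi> x * u x * partial_deriv i \<psi> x \<partial>lebesgue_on \<Omega>)
      + (\<integral>x. u x * partial_deriv i \<phi> x * \<psi> x \<partial>lebesgue_on \<Omega>)"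
    using i1 i2 by simp
  finally have "(\<integral>x. \<phi> x * u x * partial_deriv i \<psi> x \<partial>lebesgue_on \<Omega>)
      = - (\<integral>x. g x $ i * (\<phi> x * \<psi> x) \<partial>lebesgue_on \<Omega>) - (\<integral>x. u x * partial_deriv i \<phi> x * \<psi> x \<partial>lebesgue_on \<Omega>)"
    using has_weak_gradientD(3)[OF assms(3) \<phi>\<psi>, of i] by simp
  also have "\<dots> = - (\<integral>x. \<phi> x * g x $ i * \<psi> x + u x * partial_deriv i \<phi> x * \<psi> x \<partial>lebesgue_on \<Omega>)"
    using i2 i3 by (simp add: mult_ac)
  finally show "(\<integral>x. \<phi> x * u x * partial_deriv i \<psi> x \<partial>lebesgue_on \<Omega>)
      = - (\<integral>x. (\<phi> x *\<^sub>R g x + u x *\<^sub>R classical_grad \<phi> x) $ i * \<psi> x \<partial>lebesgue_on \<Omega>)"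
    by (simp add: algebra_simps)
qed

section \<open>The closure of the test functions\<close>

lemma H1_norm_eq:
  assumes "open \<Omega>" "has_weak_gradient \<Omega> w g"
  shows "H1_norm \<Omega> w = sqrt ((\<integral>x. (norm (w x))\<^sup>2 \<partial>lebesgue_on \<Omega>) + (\<integral>x. (norm (g x))\<^sup>2 \<partial>lebesgue_on \<Omega>))"
proof -
  have "(\<integral>x. (norm (weak_grad \<Omega> w x))\<^sup>2 \<partial>lebesgue_on \<Omega>) = (\<integral>x. (norm (g x))\<^sup>2 \<partial>lebesgue_on \<Omega>)"
  proof (rule integral_cong_AE)
    have "g \<in> borel_measurable (lebesgue_on \<Omega>)"
      using has_weak_gradientD(2)[OF assms(2)] by (simp add: Lp_loc_1_iff)
    then show "(\<lambda>x. (norm (g x))\<^sup>2) \<in> borel_measurable (lebesgue_on \<Omega>)"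
      by measurable
    show "(\<lambda>x. (norm (weak_grad \<Omega> w x))\<^sup>2) \<in> borel_measurable (lebesgue_on \<Omega>)"
      using weak_grad_measurable[OF assms(2)] by measurable
    show "AE x in lebesgue_on \<Omega>. (norm (weak_grad \<Omega> w x))\<^sup>2 = (norm (g x))\<^sup>2"
      using weak_grad_eq_AE[OF assms] by eventually_elim simp
  qed
  then show ?thesis
    unfolding H1_norm_def Lp_norm_2_power2 by simp
qed

lemma H1_weak_grad:
  assumes "open \<Omega>" "w \<in> H1 \<Omega>"
  shows "has_weak_gradient \<Omega> w (weak_grad \<Omega> w)" "w \<in> Lp_space 2 \<Omega>" "weak_grad \<Omega> w \<in> Lp_space 2 \<Omega>"
proof -
  obtain g where g: "g \<in> Lp_space 2 \<Omega>" "has_weak_gradient \<Omega> w g"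
    using assms(2) unfolding H1_def by blast
  show "has_weak_gradient \<Omega> w (weak_grad \<Omega> w)"
    by (rule has_weak_gradient_weak_grad[OF g(2)])
  show "w \<in> Lp_space 2 \<Omega>" using assms(2) unfolding H1_def by blast
  show "weak_grad \<Omega> w \<in> Lp_space 2 \<Omega>"
  proof (rule Lp_space_2_dominated[OF g(1) weak_grad_measurable[OF g(2)]])
    show "AE x in lebesgue_on \<Omega>. norm (weak_grad \<Omega> w x) \<le> 1 * norm (g x)"
      using weak_grad_eq_AE[OF assms(1) g(2)] by eventually_elim simp
  qed
qed

lemma H10_imp_H1: "w \<in> H10 \<Omega> \<Longrightarrow> w \<in> H1 \<Omega>"
  by (simp add: H10_def)

text \<open>
  Squared norms are plain integrals, which the limit arguments can estimate pointwise without the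
  triangle inequality of the norm.
\<close>

lemma H10_approx:
  assumes "open \<Omega>" "bounded \<Omega>" "w \<in> H10 \<Omega>" "e > 0"
  obtains \<phi> where "\<phi> \<in> test_functions \<Omega>"
    "(\<integral>x. (norm (w x - \<phi> x))\<^sup>2 \<partial>lebesgue_on \<Omega>)
      + (\<integral>x. (norm (weak_grad \<Omega> w x - classical_grad \<phi> x))\<^sup>2 \<partial>lebesgue_on \<Omega>) < e"
proof -
  obtain \<phi> where \<phi>: "\<phi> \<in> test_functions \<Omega>" "H1_norm \<Omega> (\<lambda>x. w x - \<phi> x) < sqrt e"
    using assms(3,4) unfolding H10_def by (auto dest!: spec[of _ "sqrt e"])
  have "has_weak_gradient \<Omega> (\<lambda>x. w x - \<phi> x) (\<lambda>x. weak_grad \<Omega> w x - classical_grad \<phi> x)"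
    by (intro has_weak_gradient_diff H1_weak_grad(1) has_weak_gradient_test_function \<phi> assms H10_imp_H1)
  from H1_norm_eq[OF assms(1) this] \<phi>(2) show ?thesis
    by (intro that[OF \<phi>(1)]) simp
qed

lemma H10_I:
  assumes "open \<Omega>" "bounded \<Omega>" "w \<in> Lp_space 2 \<Omega>" "g \<in> Lp_space 2 \<Omega>" "has_weak_gradient \<Omega> w g"
    and approx: "\<And>e. e > 0 \<Longrightarrow> \<exists>\<phi>\<in>test_functions \<Omega>.
      (\<integral>x. (norm (w x - \<phi> x))\<^sup>2 \<partial>lebesgue_on \<Omega>) + (\<integral>x. (norm (g x - classical_grad \<phi> x))\<^sup>2 \<partial>lebesgue_on \<Omega>) < e"
  shows "w \<in> H10 \<Omega>"
  unfolding H10_def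
proof (intro CollectI conjI allI impI)
  show "w \<in> H1 \<Omega>" using assms(3-5) unfolding H1_def by blast
  fix e :: real assume "e > 0"
  then obtain \<phi> where \<phi>: "\<phi> \<in> test_functions \<Omega>"
    "(\<integral>x. (norm (w x - \<phi> x))\<^sup>2 \<partial>lebesgue_on \<Omega>)
      + (\<integral>x. (norm (g x - classical_grad \<phi> x))\<^sup>2 \<partial>lebesgue_on \<Omega>) < e\<^sup>2"
    using approx[of "e\<^sup>2"] by auto
  have "has_weak_gradient \<Omega> (\<lambda>x. w x - \<phi> x) (\<lambda>x. g x - classical_grad \<phi> x)"
    by (intro has_weak_gradient_diff has_weak_gradient_test_function \<phi> assms)
  from H1_norm_eq[OF assms(1) this] have "H1_norm \<Omega> (\<lambda>x. w x - \<phi> x) < e"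
    using real_sqrt_less_mono[OF \<phi>(2)] \<open>e > 0\<close> by simp
  then show "\<exists>\<phi>\<in>test_functions \<Omega>. H1_norm \<Omega> (\<lambda>x. w x - \<phi> x) < e"
    using \<phi>(1) by blast
qed

lemma test_function_H10:
  assumes "open \<Omega>" "bounded \<Omega>" "\<phi> \<in> test_functions \<Omega>"
  shows "\<phi> \<in> H10 \<Omega>"
proof (rule H10_I[OF assms(1,2)])
  show "\<phi> \<in> Lp_space 2 \<Omega>" "classical_grad \<phi> \<in> Lp_space 2 \<Omega>"
    by (intro test_function_Lp_space_2 finite_measure_lebesgue_on_open assms)+
  show "has_weak_gradient \<Omega> \<phi> (classical_grad \<phi>)"
    by (intro has_weak_gradient_test_function assms)
  fix e :: real assume "e > 0"
  then show "\<exists>\<psi>\<in>test_functions \<Omega>. (\<integral>x. (norm (\<phi> x - \<psi> x))\<^sup>2 \<partial>lebesgue_on \<Omega>)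
      + (\<integral>x. (norm (classical_grad \<phi> x - classical_grad \<psi> x))\<^sup>2 \<partial>lebesgue_on \<Omega>) < e"
    by (intro bexI[OF _ assms(3)]) simp
qed

lemma classical_grad_diff:
  assumes "\<phi> \<in> test_functions \<Omega>" "\<psi> \<in> test_functions \<Omega>"
  shows "classical_grad (\<lambda>x. \<phi> x - \<psi> x) x = classical_grad \<phi> x - classical_grad \<psi> x"
proof -
  have d: "\<phi> differentiable (at x)" "\<psi> differentiable (at x)"
    using assms by (auto intro: test_function_differentiable)
  show ?thesis
    by (simp add: vec_eq_iff partial_deriv_eq[OF has_derivative_diff[OF d[unfolded frechet_derivative_works]]])
      (simp add: partial_deriv_def)
qed

lemma test_function_diff_H10:
  assumes "open \<Omega>" "bounded \<Omega>" "\<phi> \<in> test_functions \<Omega>" "w \<in> H10 \<Omega>"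
  shows "(\<lambda>x. \<phi> x - w x) \<in> H10 \<Omega>"
proof (rule H10_I[OF assms(1,2)])
  note w = H1_weak_grad[OF assms(1) H10_imp_H1[OF assms(4)]]
  note \<phi> = test_function_Lp_space_2[OF finite_measure_lebesgue_on_open[OF assms(1,2)] assms(3)]
  show "(\<lambda>x. \<phi> x - w x) \<in> Lp_space 2 \<Omega>" "(\<lambda>x. classical_grad \<phi> x - weak_grad \<Omega> w x) \<in> Lp_space 2 \<Omega>"
    by (intro Lp_space_2_diff \<phi> w)+
  show "has_weak_gradient \<Omega> (\<lambda>x. \<phi> x - w x) (\<lambda>x. classical_grad \<phi> x - weak_grad \<Omega> w x)"
    by (intro has_weak_gradient_diff has_weak_gradient_test_function assms w)
  fix e :: real assume "e > 0"
  then obtain \<psi> where \<psi>: "\<psi> \<in> test_functions \<Omega>" "(\<integral>x. (norm (w x - \<psi> x))\<^sup>2 \<partial>lebesgue_on \<Omega>)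
      + (\<integral>x. (norm (weak_grad \<Omega> w x - classical_grad \<psi> x))\<^sup>2 \<partial>lebesgue_on \<Omega>) < e"
    using H10_approx[OF assms(1,2,4)] by blast
  show "\<exists>\<eta>\<in>test_functions \<Omega>. (\<integral>x. (norm (\<phi> x - w x - \<eta> x))\<^sup>2 \<partial>lebesgue_on \<Omega>)
      + (\<integral>x. (norm (classical_grad \<phi> x - weak_grad \<Omega> w x - classical_grad \<eta> x))\<^sup>2 \<partial>lebesgue_on \<Omega>) < e"
  proof (rule bexI[OF _ test_function_diff[OF assms(3) \<psi>(1)]])
    have 1: "norm (\<phi> x - w x - (\<phi> x - \<psi> x)) = norm (w x - \<psi> x)" for x
      by (simp add: norm_minus_commute)
    have 2: "norm (classical_grad \<phi> x - weak_grad \<Omega> w x - (classical_grad \<phi> x - classical_grad \<psi> x))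
        = norm (weak_grad \<Omega> w x - classical_grad \<psi> x)" for x
      by (simp add: norm_minus_commute)
    show "(\<integral>x. (norm (\<phi> x - w x - (\<phi> x - \<psi> x)))\<^sup>2 \<partial>lebesgue_on \<Omega>)
        + (\<integral>x. (norm (classical_grad \<phi> x - weak_grad \<Omega> w x - classical_grad (\<lambda>x. \<phi> x - \<psi> x) x))\<^sup>2 \<partial>lebesgue_on \<Omega>) < e"
      unfolding classical_grad_diff[OF assms(3) \<psi>(1)] 1 2 by (rule \<psi>(2))
  qed
qed

section \<open>Chain rule and zero sets\<close>

lemma mult_le_young:
  fixes a b d :: real
  assumes "d > 0"
  shows "a * b \<le> a\<^sup>2 / d + d * b\<^sup>2"
proof -
  have "0 \<le> (a - d * b)\<^sup>2 + a\<^sup>2 + (d * b)\<^sup>2" by simp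
  then have "d * (a * b) \<le> a\<^sup>2 + d\<^sup>2 * b\<^sup>2"
    by (simp add: power2_diff power_mult_distrib mult_ac)
  then show ?thesis
    using assms by (simp add: field_simps power2_eq_square)
qed

text \<open>
  For test functions this is integration by parts for the \<open>C\<^sup>1\<close> function \<open>H \<circ> \<phi>\<close>. The defect \<open>X\<close> of the
  identity for \<open>w\<close> is estimated by the distance from \<open>w\<close> to \<open>\<phi>\<close>: the Lipschitz bounds on \<open>H\<close> and \<open>h\<close>
  turn it into products of two square integrable factors, one of which is small, so that no
  almost everywhere convergent subsequence is required.
\<close>

lemma H10_chain_rule:
  fixes \<Omega> :: "(real^'n) set"
  assumes \<Omega>: "open \<Omega>" "bounded \<Omega>" and w: "w \<in> H10 \<Omega>"
    and H: "\<And>t. (H has_real_derivative h t) (at t)"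
    and bd: "\<And>t. \<bar>h t\<bar> \<le> L" and lip: "\<And>s t. \<bar>h s - h t\<bar> \<le> L * \<bar>s - t\<bar>"
  shows "has_weak_gradient \<Omega> (\<lambda>x. H (w x)) (\<lambda>x. h (w x) *\<^sub>R weak_grad \<Omega> w x)"
  unfolding has_weak_gradient_def
proof (intro conjI ballI allI)
  let ?M = "lebesgue_on \<Omega>" and ?g = "weak_grad \<Omega> w"
  note fin = finite_measure_lebesgue_on_open[OF \<Omega>]
  interpret finite_measure ?M by (rule fin)
  note wg = H1_weak_grad[OF \<Omega>(1) H10_imp_H1[OF w]]
  note [measurable] = wg(2,3)[THEN Lp_space_2_measurable]
  have L: "0 \<le> L" using bd[of 0] by linarith
  have Hlip: "\<bar>H s - H t\<bar> \<le> L * \<bar>s - t\<bar>" for s t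
    using field_differentiable_bound[of UNIV H h L s t] H bd by simp
  have Hcont: "continuous_on UNIV H"
    using DERIV_isCont[OF H] by (simp add: continuous_at_imp_continuous_on)
  have hcont: "continuous_on UNIV h"
    by (rule lipschitz_on_continuous_on[of L]) (use lip L in \<open>auto intro!: lipschitz_onI simp: dist_real_def\<close>)
  have [measurable]: "H \<in> borel_measurable borel" "h \<in> borel_measurable borel"
    using Hcont hcont by (simp_all add: borel_measurable_continuous_onI)
  have Hw: "integrable ?M (\<lambda>x. H (w x))"
  proof (rule Bochner_Integration.integrable_bound)
    show "integrable ?M (\<lambda>x. \<bar>H 0\<bar> + L * \<bar>w x\<bar>)"
      using integrable_if_Lp_space_2[OF fin wg(2)] by simp
    show "AE x in ?M. norm (H (w x)) \<le> norm (\<bar>H 0\<bar> + L * \<bar>w x\<bar>)"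
    proof (rule AE_I2)
      fix x show "norm (H (w x)) \<le> norm (\<bar>H 0\<bar> + L * \<bar>w x\<bar>)"
        using Hlip[of "w x" 0] L by simp
    qed
  qed measurable
  have hw: "(\<lambda>x. h (w x) *\<^sub>R ?g x) \<in> Lp_space 2 \<Omega>"
    by (rule Lp_space_2_scaleR[OF wg(3), of _ L]) (use bd in auto)
  show "(\<lambda>x. H (w x)) \<in> Lp_loc 1 \<Omega>" "(\<lambda>x. h (w x) *\<^sub>R ?g x) \<in> Lp_loc 1 \<Omega>"
    by (intro Lp_loc_1_if_integrable \<Omega> Hw integrable_if_Lp_space_2[OF fin hw])+
  fix \<psi> i assume \<psi>: "\<psi> \<in> test_functions \<Omega>"
  let ?d = "partial_deriv i \<psi>"
  note \<psi>2 = test_function_Lp_space_2[OF fin \<psi>]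
  note d2 = test_function_Lp_space_2(1)[OF fin test_function_partial_deriv[OF \<psi>, of i]]
  note [measurable] = test_function_measurable[OF \<psi>]
    test_function_measurable[OF test_function_partial_deriv[OF \<psi>]]
  obtain C where C: "\<And>x. \<bar>\<psi> x\<bar> \<le> C"
    using test_function_bounded[OF \<psi>] by blast
  define X where "X = (\<integral>x. H (w x) * ?d x \<partial>?M) + (\<integral>x. (h (w x) *\<^sub>R ?g x) $ i * \<psi> x \<partial>?M)"
  have iX1: "integrable ?M (\<lambda>x. H (w x) * ?d x)"
    using integrable_test_scaleR[OF \<Omega>(1) Lp_loc_1_if_integrable[OF \<Omega>(1) Hw] test_function_partial_deriv[OF \<psi>, of i]]
    by (simp add: mult.commute)
  have iX2: "integrable ?M (\<lambda>x. (h (w x) *\<^sub>R ?g x) $ i * \<psi> x)"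
    using integrable_test_scaleR[OF \<Omega>(1) Lp_loc_1_nth[OF Lp_loc_1_if_integrable[OF \<Omega>(1)
            integrable_if_Lp_space_2[OF fin hw]]] \<psi>, of i]
    by (simp add: mult.commute)
  \<comment> \<open>\<open>b1\<close> and \<open>b2\<close> are the weights that multiply \<open>|w - \<phi>|\<close> and \<open>|D w - D \<phi>|\<close> in the defect.\<close>
  define b1 where "b1 x = L * (\<bar>?d x\<bar> + norm (?g x) * \<bar>\<psi> x\<bar>)" for x
  define b2 where "b2 x = L * \<bar>\<psi> x\<bar>" for x
  have "(\<lambda>x. L * \<bar>\<psi> x\<bar>) \<in> Lp_space 2 \<Omega>"
    by (rule Lp_space_2_dominated[OF \<psi>2(1), of _ L]) (use L in \<open>auto simp: abs_mult\<close>)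
  then have b2: "b2 \<in> Lp_space 2 \<Omega>"
    unfolding b2_def .
  have "(\<lambda>x. norm (?g x) * \<bar>\<psi> x\<bar>) \<in> Lp_space 2 \<Omega>"
    by (rule Lp_space_2_dominated[OF wg(3), of _ C])
      (use C in \<open>auto simp: abs_mult mult.commute[of _ "\<bar>\<psi> _\<bar>"] intro!: mult_right_mono\<close>)
  moreover have "(\<lambda>x. \<bar>?d x\<bar>) \<in> Lp_space 2 \<Omega>"
    by (rule Lp_space_2_dominated[OF d2, of _ 1]) auto
  ultimately have "(\<lambda>x. \<bar>?d x\<bar> + norm (?g x) * \<bar>\<psi> x\<bar>) \<in> Lp_space 2 \<Omega>"
    by (rule Lp_space_2_add[rotated])
  from Lp_space_2_scaleR[OF this, of "\<lambda>_. L" L] have b1: "b1 \<in> Lp_space 2 \<Omega>"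
    unfolding b1_def using L by simp
  define B where "B = (\<integral>x. (norm (b1 x))\<^sup>2 \<partial>?M) + (\<integral>x. (norm (b2 x))\<^sup>2 \<partial>?M)"
  have B: "0 \<le> B" unfolding B_def by (intro add_nonneg_nonneg integral_nonneg_AE) auto
  have small: "\<bar>X\<bar> \<le> \<eta>" if "\<eta> > 0" for \<eta>
  proof -
    \<comment> \<open>The weight \<open>\<delta>\<close> in Young's inequality lets the fixed factors contribute at most \<open>\<eta> / 2\<close>,
        and the accuracy of \<open>\<phi>\<close> is chosen after it.\<close>
    define \<delta> where "\<delta> = \<eta> / (2 * (B + 1))"
    have \<delta>: "\<delta> > 0" "\<delta> * B \<le> \<eta> / 2"
      using \<open>\<eta> > 0\<close> B by (auto simp: \<delta>_def field_simps)
    obtain \<phi> where \<phi>: "\<phi> \<in> test_functions \<Omega>"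
      "(\<integral>x. (norm (w x - \<phi> x))\<^sup>2 \<partial>?M) + (\<integral>x. (norm (?g x - classical_grad \<phi> x))\<^sup>2 \<partial>?M) < \<delta> * \<eta> / 2"
      using H10_approx[OF \<Omega> w, of "\<delta> * \<eta> / 2"] \<delta>(1) \<open>\<eta> > 0\<close> by auto
    let ?p = "partial_deriv i \<phi>"
    note \<phi>2 = test_function_Lp_space_2[OF fin \<phi>(1)]
    note a1 = Lp_space_2_diff[OF wg(2) \<phi>2(1)] and a2 = Lp_space_2_diff[OF wg(3) \<phi>2(2)]
    have pd: "partial_deriv i (\<lambda>x. H (\<phi> x)) = (\<lambda>x. h (\<phi> x) * partial_deriv i \<phi> x)" for i
      by (rule ext) (rule partial_deriv_compose_real[OF H test_function_differentiable[OF \<phi>(1)]])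
    have \<phi>c: "continuous_on UNIV \<phi>" "continuous_on UNIV (partial_deriv i \<phi>)" for i
      by (intro test_function_continuous[of _ \<Omega>] test_function_partial_deriv \<phi>(1))+
    have cHh: "continuous_on UNIV (\<lambda>x. H (\<phi> x))" "continuous_on UNIV (\<lambda>x. h (\<phi> x) * partial_deriv i \<phi> x)" for i
      by (intro continuous_intros continuous_on_compose2[OF Hcont] continuous_on_compose2[OF hcont] \<phi>c; simp)+
    have C1: "Ck (Suc 0) (\<lambda>x. H (\<phi> x))"
      unfolding Ck_1_iff pd
    proof (intro conjI allI cHh)
      show "(\<lambda>x. H (\<phi> x)) differentiable (at x)" for x
        using differentiable_chain_at[OF test_function_differentiable[OF \<phi>(1), of x]
            differentiableI[OF has_field_derivative_imp_has_derivative[OF H]]]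
        by (simp only: o_def)
    qed
    note loc = Lp_loc_1_if_continuous
    have iY1: "integrable ?M (\<lambda>x. H (\<phi> x) * ?d x)"
      using integrable_test_scaleR[OF \<Omega>(1) loc[OF cHh(1)] test_function_partial_deriv[OF \<psi>, of i]]
      by (simp add: mult.commute)
    have iY2: "integrable ?M (\<lambda>x. h (\<phi> x) * ?p x * \<psi> x)"
      using integrable_test_scaleR[OF \<Omega>(1) loc[OF cHh(2)] \<psi>, of i] by (simp add: mult.commute)
    have Y: "(\<integral>x. H (\<phi> x) * ?d x \<partial>?M) + (\<integral>x. h (\<phi> x) * ?p x * \<psi> x \<partial>?M) = 0"
      using integral_by_parts_C1[OF \<Omega>(1) C1 \<psi>, of i] unfolding pd by simp
    let ?Z = "\<lambda>x. (H (w x) * ?d x + (h (w x) *\<^sub>R ?g x) $ i * \<psi> x)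
        - (H (\<phi> x) * ?d x + h (\<phi> x) * ?p x * \<psi> x)"
    have XZ: "X = (\<integral>x. ?Z x \<partial>?M)"
      using Y iX1 iX2 iY1 iY2 unfolding X_def by simp
    have "\<bar>X\<bar> \<le> (\<integral>x. \<bar>?Z x\<bar> \<partial>?M)"
      unfolding XZ by (rule integral_abs_bound)
    also have "\<dots> \<le> (\<integral>x. ((norm (w x - \<phi> x))\<^sup>2 / \<delta> + \<delta> * (norm (b1 x))\<^sup>2)
        + ((norm (?g x - classical_grad \<phi> x))\<^sup>2 / \<delta> + \<delta> * (norm (b2 x))\<^sup>2) \<partial>?M)"
    proof (rule Bochner_Integration.integral_mono)
      show "integrable ?M (\<lambda>x. \<bar>?Z x\<bar>)"
        using iX1 iX2 iY1 iY2 by (intro integrable_abs Bochner_Integration.integrable_diff Bochner_Integration.integrable_add)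
      show "integrable ?M (\<lambda>x. ((norm (w x - \<phi> x))\<^sup>2 / \<delta> + \<delta> * (norm (b1 x))\<^sup>2)
          + ((norm (?g x - classical_grad \<phi> x))\<^sup>2 / \<delta> + \<delta> * (norm (b2 x))\<^sup>2))"
        using a1[THEN Lp_space_2_integrable] a2[THEN Lp_space_2_integrable]
          b1[THEN Lp_space_2_integrable] b2[THEN Lp_space_2_integrable] by simp
      fix x
      let ?a1 = "norm (w x - \<phi> x)" and ?a2 = "norm (?g x - classical_grad \<phi> x)"
      have Z: "?Z x = (H (w x) - H (\<phi> x)) * ?d x
          + (h (\<phi> x) * (?g x - classical_grad \<phi> x) $ i + (h (w x) - h (\<phi> x)) * ?g x $ i) * \<psi> x"
        by (simp add: algebra_simps)
      have "\<bar>?Z x\<bar> \<le> \<bar>H (w x) - H (\<phi> x)\<bar> * \<bar>?d x\<bar>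
          + (\<bar>h (\<phi> x)\<bar> * \<bar>(?g x - classical_grad \<phi> x) $ i\<bar> + \<bar>h (w x) - h (\<phi> x)\<bar> * \<bar>?g x $ i\<bar>) * \<bar>\<psi> x\<bar>"
        unfolding Z
        by (rule order_trans[OF abs_triangle_ineq add_mono], simp add: abs_mult, unfold abs_mult)
          (rule mult_right_mono[OF order_trans[OF abs_triangle_ineq]], simp_all add: abs_mult)
      also have "\<dots> \<le> (L * ?a1) * \<bar>?d x\<bar> + (L * ?a2 + (L * ?a1) * norm (?g x)) * \<bar>\<psi> x\<bar>"
        using bd lip Hlip L component_le_norm_cart[of "?g x - classical_grad \<phi> x" i] component_le_norm_cart[of "?g x" i]
        by (intro add_mono mult_mono mult_right_mono) auto
      also have "\<dots> = ?a1 * norm (b1 x) + ?a2 * norm (b2 x)"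
        using L by (simp add: b1_def b2_def algebra_simps abs_mult)
      also have "\<dots> \<le> (?a1\<^sup>2 / \<delta> + \<delta> * (norm (b1 x))\<^sup>2) + (?a2\<^sup>2 / \<delta> + \<delta> * (norm (b2 x))\<^sup>2)"
        by (intro add_mono mult_le_young \<delta>(1))
      finally show "\<bar>?Z x\<bar> \<le> (?a1\<^sup>2 / \<delta> + \<delta> * (norm (b1 x))\<^sup>2) + (?a2\<^sup>2 / \<delta> + \<delta> * (norm (b2 x))\<^sup>2)" .
    qed
    also have "\<dots> = ((\<integral>x. (norm (w x - \<phi> x))\<^sup>2 \<partial>?M) + (\<integral>x. (norm (?g x - classical_grad \<phi> x))\<^sup>2 \<partial>?M)) / \<delta> + \<delta> * B"
      using a1[THEN Lp_space_2_integrable] a2[THEN Lp_space_2_integrable]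
        b1[THEN Lp_space_2_integrable] b2[THEN Lp_space_2_integrable]
      by (simp add: B_def add_divide_distrib distrib_left)
    also have "\<dots> \<le> (\<delta> * \<eta> / 2) / \<delta> + \<eta> / 2"
      using \<phi>(2) \<delta> by (intro add_mono divide_right_mono) auto
    also have "\<dots> = \<eta>" using \<delta>(1) by simp
    finally show ?thesis .
  qed
  have "X = 0"
    using small[of "\<bar>X\<bar> / 2"] by (cases "X = 0") auto
  then show "(\<integral>x. H (w x) * ?d x \<partial>?M) = - (\<integral>x. (h (w x) *\<^sub>R ?g x) $ i * \<psi> x \<partial>?M)"
    unfolding X_def by simp
qed

lemma reciprocal_one_plus_square_lipschitz:
  "\<bar>1 / (1 + a\<^sup>2) - 1 / (1 + b\<^sup>2)\<bar> \<le> \<bar>a - b\<bar>" for a b :: real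
proof -
  have p: "1 + a\<^sup>2 > 0" "1 + b\<^sup>2 > 0" by (simp_all add: add_pos_nonneg)
  have "\<bar>a + b\<bar> \<le> \<bar>a\<bar> + \<bar>b\<bar>" by simp
  also have "\<dots> \<le> (1 + a\<^sup>2) / 2 + (1 + b\<^sup>2) / 2"
  proof -
    have "2 * \<bar>a\<bar> \<le> 1 + a\<^sup>2" "2 * \<bar>b\<bar> \<le> 1 + b\<^sup>2"
      using sum_squares_bound[of 1 "\<bar>a\<bar>"] sum_squares_bound[of 1 "\<bar>b\<bar>"] by auto
    then show ?thesis by argo
  qed
  also have "\<dots> \<le> (1 + a\<^sup>2) * (1 + b\<^sup>2)"
  proof -
    have "(1 + a\<^sup>2) * (1 + b\<^sup>2) = 1 + a\<^sup>2 + b\<^sup>2 + a\<^sup>2 * b\<^sup>2" by (simp add: algebra_simps)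
    moreover have "0 \<le> a\<^sup>2" "0 \<le> b\<^sup>2" "0 \<le> a\<^sup>2 * b\<^sup>2" by simp_all
    ultimately show ?thesis by argo
  qed
  finally have 1: "\<bar>a + b\<bar> \<le> (1 + a\<^sup>2) * (1 + b\<^sup>2)" .
  have "1 / (1 + a\<^sup>2) - 1 / (1 + b\<^sup>2) = (b - a) * (a + b) / ((1 + a\<^sup>2) * (1 + b\<^sup>2))"
    using p by (simp add: field_simps power2_eq_square)
  also have "\<bar>\<dots>\<bar> = \<bar>a - b\<bar> * (\<bar>a + b\<bar> / ((1 + a\<^sup>2) * (1 + b\<^sup>2)))"
    using p by (simp add: abs_mult abs_minus_commute)
  also have "\<dots> \<le> \<bar>a - b\<bar> * 1"
    using 1 p by (intro mult_left_mono) (auto simp: divide_le_eq_1)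
  finally show ?thesis by simp
qed

text \<open>
  Stampacchia's lemma. The functions \<open>arctan (n t) / n\<close> tend to \<open>0\<close> uniformly, while their derivatives
  \<open>1 / (1 + n\<^sup>2 t\<^sup>2)\<close> decrease to the indicator of \<open>{0}\<close>. Hence in the limit of the chain rule the
  gradient restricted to the zero set of \<open>w\<close> is the weak gradient of \<open>0\<close>.
\<close>

lemma H10_weak_grad_eq_0_on_zero_set:
  fixes \<Omega> :: "(real^'n) set"
  assumes \<Omega>: "open \<Omega>" "bounded \<Omega>" and w: "w \<in> H10 \<Omega>"
  shows "AE x in lebesgue_on \<Omega>. w x = 0 \<longrightarrow> weak_grad \<Omega> w x = 0"
proof -
  let ?M = "lebesgue_on \<Omega>" and ?g = "weak_grad \<Omega> w"
  note fin = finite_measure_lebesgue_on_open[OF \<Omega>]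
  note wg = H1_weak_grad[OF \<Omega>(1) H10_imp_H1[OF w]]
  note [measurable] = wg(2,3)[THEN Lp_space_2_measurable]
  define H where "H n t = arctan (real (Suc n) * t) / real (Suc n)" for n t
  define h where "h n t = 1 / (1 + (real (Suc n) * t)\<^sup>2)" for n t
  have h_le: "0 \<le> h n t" "h n t \<le> 1" for n t
    using add_pos_nonneg[OF zero_less_one zero_le_power2[of "real (Suc n) * t"]]
    by (simp_all add: h_def divide_le_eq_1_pos del: of_nat_Suc)
  have chain: "has_weak_gradient \<Omega> (\<lambda>x. H n (w x)) (\<lambda>x. h n (w x) *\<^sub>R ?g x)" for n
  proof (rule H10_chain_rule[OF \<Omega> w, where L="real (Suc n)"])
    show "(H n has_real_derivative h n t) (at t)" for t
    proof -
      have "((\<lambda>t. arctan (real (Suc n) * t) / real (Suc n)) has_real_derivative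
          inverse (1 + (real (Suc n) * t)\<^sup>2) * real (Suc n) / real (Suc n)) (at t)"
        by (intro DERIV_cdivide DERIV_chain2[OF DERIV_arctan] DERIV_cmult_Id)
      then show ?thesis
        unfolding H_def[abs_def] h_def by (simp add: inverse_eq_divide del: of_nat_Suc)
    qed
    show "\<bar>h n t\<bar> \<le> real (Suc n)" for t
      using h_le[of n t] by simp
    show "\<bar>h n s - h n t\<bar> \<le> real (Suc n) * \<bar>s - t\<bar>" for s t
      using reciprocal_one_plus_square_lipschitz[of "real (Suc n) * s" "real (Suc n) * t"]
      unfolding h_def by (simp add: abs_mult flip: right_diff_distrib del: of_nat_Suc)
  qed
  define g0 where "g0 i x = indicator {x. w x = 0} x * ?g x $ i" for i x
  have "AE x in ?M. g0 i x = 0" for i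
  proof (rule fundamental_lemma[OF \<Omega>(1)])
    note gi = Lp_loc_1_nth[OF Lp_loc_1_if_integrable[OF \<Omega>(1) integrable_if_Lp_space_2[OF fin wg(3)]], of i]
    have "(\<lambda>x. indicat_real {x. w x = 0} x) \<in> borel_measurable ?M"
      by measurable
    from Lp_loc_1_scaleR[OF gi this, of 1] show "g0 i \<in> Lp_loc 1 \<Omega>"
      unfolding g0_def by (simp add: indicator_def)
    fix \<psi> assume \<psi>: "\<psi> \<in> test_functions \<Omega>"
    let ?d = "partial_deriv i \<psi>"
    note [measurable] = test_function_measurable[OF \<psi>, of \<Omega>]
      test_function_measurable[OF test_function_partial_deriv[OF \<psi>], of i \<Omega>]
    have [measurable]: "(\<lambda>x. ?g x $ i) \<in> borel_measurable ?M"
      using gi unfolding Lp_loc_1_iff by blast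
    have gi\<psi>: "integrable ?M (\<lambda>x. ?g x $ i * \<psi> x)"
      using integrable_test_scaleR[OF \<Omega>(1) gi \<psi>] by (simp add: mult.commute)
    have d: "integrable ?M (\<lambda>x. 2 * \<bar>?d x\<bar>)"
      using integrable_if_Lp_space_2[OF fin test_function_Lp_space_2(1)[OF fin test_function_partial_deriv[OF \<psi>]], of i]
      by simp
    have [measurable]: "H n \<in> borel_measurable borel" "h n \<in> borel_measurable borel" for n
      unfolding H_def h_def by measurable
    have "(\<lambda>n. \<integral>x. H n (w x) * ?d x \<partial>?M) \<longlonglongrightarrow> (\<integral>x. 0 \<partial>?M)"
    proof (rule integral_dominated_convergence[OF _ _ d])
      have Hb: "\<bar>H n t\<bar> \<le> 2 * inverse (real (Suc n))" for n t
      proof -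
        have "\<bar>arctan (real (Suc n) * t)\<bar> \<le> 2"
          using arctan_bounded[of "real (Suc n) * t"] pi_less_4 by (simp add: abs_le_iff)
        then show ?thesis
          unfolding H_def by (simp add: abs_mult divide_inverse mult_right_mono del: of_nat_Suc)
      qed
      show "AE x in ?M. (\<lambda>n. H n (w x) * ?d x) \<longlonglongrightarrow> 0"
      proof (rule AE_I2)
        fix x
        have "(\<lambda>n. 2 * inverse (real (Suc n))) \<longlonglongrightarrow> 2 * 0"
          by (intro tendsto_intros LIMSEQ_inverse_real_of_nat)
        then have lim: "(\<lambda>n. 2 * inverse (real (Suc n))) \<longlonglongrightarrow> 0" by simp
        have "(\<lambda>n. H n (w x)) \<longlonglongrightarrow> 0"
          by (rule Lim_null_comparison[OF _ lim]) (simp add: Hb del: of_nat_Suc)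
        from tendsto_mult_left_zero[OF this] show "(\<lambda>n. H n (w x) * ?d x) \<longlonglongrightarrow> 0" .
      qed
      show "AE x in ?M. norm (H n (w x) * ?d x) \<le> 2 * \<bar>?d x\<bar>" for n
      proof (rule AE_I2)
        fix x
        have "inverse (real (Suc n)) \<le> 1" by (simp add: inverse_eq_divide)
        then have "\<bar>H n (w x)\<bar> \<le> 2" using Hb[of n "w x"] by linarith
        then show "norm (H n (w x) * ?d x) \<le> 2 * \<bar>?d x\<bar>"
          by (simp add: abs_mult mult_right_mono)
      qed
    qed measurable
    moreover have "(\<lambda>n. \<integral>x. h n (w x) * (?g x $ i * \<psi> x) \<partial>?M) \<longlonglongrightarrow> (\<integral>x. g0 i x * \<psi> x \<partial>?M)"
    proof (rule integral_dominated_convergence[OF _ _ integrable_abs[OF gi\<psi>]])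
      have hl: "(\<lambda>n. h n t) \<longlonglongrightarrow> (if t = 0 then 1 else 0)" for t
      proof (cases "t = 0")
        case False
        have "(\<lambda>n. h n t) \<longlonglongrightarrow> 0"
        proof (rule tendsto_sandwich[OF _ _ tendsto_const])
          have "(\<lambda>n. inverse (real (Suc n)) * (1 / t\<^sup>2)) \<longlonglongrightarrow> 0 * (1 / t\<^sup>2)"
            by (intro tendsto_intros LIMSEQ_inverse_real_of_nat)
          then show "(\<lambda>n. inverse (real (Suc n)) * (1 / t\<^sup>2)) \<longlonglongrightarrow> 0" by simp
          have "h n t \<le> inverse (real (Suc n)) * (1 / t\<^sup>2)" for n
          proof -
            have "real (Suc n) * 1 \<le> real (Suc n) * real (Suc n)"
              by (intro mult_left_mono) auto
            then have "real (Suc n) * t\<^sup>2 \<le> (real (Suc n))\<^sup>2 * t\<^sup>2"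
              by (intro mult_right_mono) (auto simp: power2_eq_square)
            then have "real (Suc n) * t\<^sup>2 \<le> 1 + (real (Suc n) * t)\<^sup>2"
              unfolding power_mult_distrib by linarith
            then have "1 / (1 + (real (Suc n) * t)\<^sup>2) \<le> 1 / (real (Suc n) * t\<^sup>2)"
              using False by (intro divide_left_mono mult_pos_pos add_pos_nonneg) auto
            then show ?thesis by (simp add: h_def inverse_eq_divide)
          qed
          then show "\<forall>\<^sub>F n in sequentially. h n t \<le> inverse (real (Suc n)) * (1 / t\<^sup>2)" by simp
        qed (use h_le in auto)
        then show ?thesis using False by simp
      qed (simp add: h_def)
      show "AE x in ?M. (\<lambda>n. h n (w x) * (?g x $ i * \<psi> x)) \<longlonglongrightarrow> g0 i x * \<psi> x"
      proof (rule AE_I2)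
        fix x
        show "(\<lambda>n. h n (w x) * (?g x $ i * \<psi> x)) \<longlonglongrightarrow> g0 i x * \<psi> x"
          using tendsto_mult_right[OF hl[of "w x"], of "?g x $ i * \<psi> x"]
          by (cases "w x = 0") (simp_all add: g0_def)
      qed
      show "AE x in ?M. norm (h n (w x) * (?g x $ i * \<psi> x)) \<le> \<bar>?g x $ i * \<psi> x\<bar>" for n
        using h_le by (auto simp: abs_mult intro!: AE_I2 mult_left_le_one_le)
      show "(\<lambda>x. g0 i x * \<psi> x) \<in> borel_measurable ?M"
        unfolding g0_def by measurable
    qed measurable
    moreover have "(\<integral>x. H n (w x) * ?d x \<partial>?M) = - (\<integral>x. h n (w x) * (?g x $ i * \<psi> x) \<partial>?M)" for n
      using has_weak_gradientD(3)[OF chain \<psi>, of n i] by (simp add: mult.assoc)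
    ultimately have "(\<lambda>n. - (\<integral>x. h n (w x) * (?g x $ i * \<psi> x) \<partial>?M)) \<longlonglongrightarrow> 0"
      "(\<lambda>n. - (\<integral>x. h n (w x) * (?g x $ i * \<psi> x) \<partial>?M)) \<longlonglongrightarrow> - (\<integral>x. g0 i x * \<psi> x \<partial>?M)"
      by (auto intro: tendsto_minus)
    from LIMSEQ_unique[OF this] show "(\<integral>x. g0 i x * \<psi> x \<partial>?M) = 0" by simp
  qed
  then have "AE x in ?M. \<forall>i\<in>UNIV. g0 i x = 0"
    by (intro AE_finite_allI) auto
  then show ?thesis
    by eventually_elim (auto simp: g0_def vec_eq_iff)
qed

section \<open>Bounded matrix fields\<close>

lemma borel_measurable_vec:
  fixes f :: "'a \<Rightarrow> 'b::euclidean_space^'n"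
  assumes "\<And>i. (\<lambda>x. f x $ i) \<in> borel_measurable M"
  shows "f \<in> borel_measurable M"
proof (subst borel_measurable_euclidean_space, rule ballI)
  fix b :: "'b^'n" assume "b \<in> Basis"
  then obtain i c where b: "b = axis i c" unfolding Basis_vec_def by blast
  show "(\<lambda>x. f x \<bullet> b) \<in> borel_measurable M"
    unfolding b inner_axis using assms[of i] by measurable
qed

lemma borel_measurable_matrix_vector_mult:
  fixes A :: "'a \<Rightarrow> real^'n^'m" and z :: "'a \<Rightarrow> real^'n"
  assumes "\<And>i j. (\<lambda>x. A x $ i $ j) \<in> borel_measurable M" "z \<in> borel_measurable M"
  shows "(\<lambda>x. A x *v z x) \<in> borel_measurable M"
proof (rule borel_measurable_vec)
  fix i
  have "(\<lambda>x. z x $ j) \<in> borel_measurable M" for j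
    unfolding cart_eq_inner_axis using assms(2) by measurable
  then show "(\<lambda>x. (A x *v z x) $ i) \<in> borel_measurable M"
    unfolding matrix_vector_mult_def using assms(1)
    by (simp add: borel_measurable_sum borel_measurable_times)
qed

lemma inner_transpose_matrix_vector:
  "(transpose A *v z) \<bullet> y = z \<bullet> (A *v y)" for A :: "real^'n^'m"
  by (metis dot_lmul_matrix inner_commute transpose_matrix_vector)

lemma norm_transpose_matrix_vector_le:
  fixes A :: "real^'n^'m"
  assumes "\<And>\<xi>. norm (A *v \<xi>) \<le> M * norm \<xi>"
  shows "norm (transpose A *v z) \<le> M * norm z"
proof -
  let ?y = "transpose A *v z"
  have "norm ?y * norm ?y = ?y \<bullet> ?y"
    by (simp only: dot_square_norm power2_eq_square)
  also have "\<dots> = z \<bullet> (A *v ?y)"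
    by (rule inner_transpose_matrix_vector)
  also have "\<dots> \<le> norm z * (M * norm ?y)"
    using norm_cauchy_schwarz[of z "A *v ?y"] mult_left_mono[OF assms[of ?y] norm_ge_zero[of z]] by linarith
  finally have "norm ?y * norm ?y \<le> (M * norm z) * norm ?y" by (simp add: mult_ac)
  moreover have "0 \<le> M * norm z"
  proof -
    have "0 \<le> M" using order_trans[OF norm_ge_zero assms[of "axis undefined 1"]] by (simp add: norm_axis_1)
    then show ?thesis by simp
  qed
  ultimately show ?thesis
    by (metis mult_right_le_imp_le norm_ge_zero order_le_less)
qed

text \<open>
  Needed for the measurability of \<open>x \<mapsto> onorm (A x)\<close>: the essential supremum of a nonmeasurable
  function is \<open>\<infinity>\<close> by convention, which \<open>enn2real\<close> turns into \<open>0\<close>.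
\<close>

lemma continuous_on_onorm_matrix: "continuous_on UNIV (\<lambda>A :: real^'n^'m. onorm ((*v) A))"
proof (rule lipschitz_on_continuous_on)
  let ?C = "real CARD('m) * real CARD('n)"
  have bl: "bounded_linear ((*v) A)" for A :: "real^'n^'m"
    by (simp add: linear_conv_bounded_linear[symmetric])
  have 1: "onorm ((*v) A) - onorm ((*v) B) \<le> ?C * dist A B" for A B :: "real^'n^'m"
  proof -
    have "(*v) A = (\<lambda>x. (A - B) *v x + B *v x)"
      by (rule ext) (simp add: matrix_vector_mult_diff_rdistrib)
    then have "onorm ((*v) A) \<le> onorm ((*v) (A - B)) + onorm ((*v) B)"
      using onorm_triangle[OF bl[of "A - B"] bl[of B]] by simp
    also have "onorm ((*v) (A - B)) \<le> ?C * dist A B"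
    proof (rule onorm_le_matrix_component)
      fix i j
      show "\<bar>(A - B) $ i $ j\<bar> \<le> dist A B"
        using component_le_norm_cart[of "(A - B) $ i" j] Finite_Cartesian_Product.norm_nth_le[of "A - B" i]
        unfolding dist_norm by linarith
    qed
    finally show ?thesis by simp
  qed
  show "?C-lipschitz_on UNIV (\<lambda>A :: real^'n^'m. onorm ((*v) A))"
  proof (rule lipschitz_onI)
    fix A B :: "real^'n^'m"
    show "dist (onorm ((*v) A)) (onorm ((*v) B)) \<le> ?C * dist A B"
      using 1[of A B] 1[of B A] by (simp add: dist_real_def abs_le_iff dist_commute)
  qed simp
qed

text \<open>
  The bound on the entries makes the essential supremum finite, so that its conversion to a real
  number loses nothing.
\<close>

lemma matrix_Linf_norm_bound:
  fixes A :: "real^'n \<Rightarrow> real^'n^'n"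
  assumes "\<And>i j. (\<lambda>x. A x $ i $ j) \<in> Lp_space \<infinity> \<Omega>"
  shows "AE x in lebesgue_on \<Omega>. \<forall>\<xi>. norm (A x *v \<xi>) \<le> matrix_Linf_norm \<Omega> A * norm \<xi>"
proof -
  let ?M = "lebesgue_on \<Omega>" and ?n = "\<lambda>x. onorm ((*v) (A x))"
  have "A \<in> borel_measurable ?M"
    using assms by (intro borel_measurable_vec) (auto simp: Lp_space_def)
  from measurable_compose[OF this borel_measurable_continuous_onI[OF continuous_on_onorm_matrix]]
  have [measurable]: "?n \<in> borel_measurable ?M" .
  have bl: "bounded_linear ((*v) B)" for B :: "real^'n^'n"
    by (simp add: linear_conv_bounded_linear[symmetric])
  have n0: "0 \<le> ?n x" for x by (rule onorm_pos_le[OF bl])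
  have "\<exists>c. AE x in ?M. \<bar>A x $ i $ j\<bar> \<le> c" for i j
    using assms[of i j] by (simp add: Lp_space_def)
  then obtain c where "\<And>i j. AE x in ?M. \<bar>A x $ i $ j\<bar> \<le> c i j" by metis
  then have "AE x in ?M. \<forall>i\<in>UNIV. \<forall>j\<in>UNIV. \<bar>A x $ i $ j\<bar> \<le> c i j"
    by (intro AE_finite_allI) auto
  then have "AE x in ?M. ennreal (norm (?n x)) \<le> ennreal (\<Sum>i\<in>UNIV. \<Sum>j\<in>UNIV. c i j)"
  proof eventually_elim
    case (elim x)
    have "?n x \<le> (\<Sum>i\<in>UNIV. \<Sum>j\<in>UNIV. c i j)"
      by (rule order_trans[OF onorm_le_matrix_component_sum]) (use elim in \<open>intro sum_mono, blast\<close>)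
    then show ?case using n0[of x] by (intro ennreal_leI) simp
  qed
  then have "esssup ?M (\<lambda>x. ennreal (norm (?n x))) \<le> ennreal (\<Sum>i\<in>UNIV. \<Sum>j\<in>UNIV. c i j)"
    by (intro esssup_I) auto
  then have fin: "esssup ?M (\<lambda>x. ennreal (norm (?n x))) < top"
    by (rule le_less_trans) (simp add: less_top[symmetric])
  have "AE x in ?M. ennreal (norm (?n x)) \<le> esssup ?M (\<lambda>x. ennreal (norm (?n x)))"
    by (rule esssup_AE)
  then show ?thesis
  proof eventually_elim
    case (elim x)
    have le: "?n x \<le> matrix_Linf_norm \<Omega> A"
      unfolding matrix_Linf_norm_def Lp_norm_def
      using enn2real_mono[OF elim fin] n0[of x] by simp
    show ?case
    proof
      fix \<xi>
      show "norm (A x *v \<xi>) \<le> matrix_Linf_norm \<Omega> A * norm \<xi>"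
        using onorm[OF bl[of "A x"], of \<xi>] mult_right_mono[OF le norm_ge_zero[of \<xi>]] by linarith
    qed
  qed
qed

section \<open>The energy estimate\<close>

lemma trunc_eq_diff_trunc_rest: "trunc k s = s - trunc_rest k s"
  by (simp add: trunc_rest_def)

lemma trunc_bounds: "k > 0 \<Longrightarrow> s \<ge> 0 \<Longrightarrow> 0 \<le> trunc k s \<and> trunc k s \<le> k"
  by (auto simp: trunc_def)

lemma abs_trunc_le: "k > 0 \<Longrightarrow> \<bar>trunc k s\<bar> \<le> k"
  by (auto simp: trunc_def)

lemma trunc_eq_or_rest_eq_0: "k > 0 \<Longrightarrow> s \<ge> 0 \<Longrightarrow> trunc k s = k \<or> trunc_rest k s = 0"
  by (auto simp: trunc_def trunc_rest_def)

lemma borel_measurable_trunc: "trunc k \<in> borel_measurable borel"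
  unfolding trunc_def[abs_def] by measurable

lemma test_function_Lp_space_infinity:
  assumes "\<phi> \<in> test_functions \<Omega>"
  shows "\<phi> \<in> Lp_space \<infinity> \<Omega>"
proof -
  obtain C where "\<And>x. \<bar>\<phi> x\<bar> \<le> C" using test_function_bounded[OF assms] by blast
  then have "AE x in lebesgue_on \<Omega>. norm (\<phi> x) \<le> C" by simp
  then show ?thesis
    using test_function_measurable[OF assms] unfolding Lp_space_def by auto
qed

lemma classical_grad_mult:
  assumes "\<phi> \<in> test_functions \<Omega>" "\<psi> \<in> test_functions \<Omega>"
  shows "classical_grad (\<lambda>x. \<phi> x * \<psi> x) x = \<phi> x *\<^sub>R classical_grad \<psi> x + \<psi> x *\<^sub>R classical_grad \<phi> x"
  by (simp add: vec_eq_iff partial_deriv_mult[OF assms[THEN test_function_differentiable]] mult.commute)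

lemma classical_grad_mult_const:
  assumes "\<phi> \<in> test_functions \<Omega>"
  shows "classical_grad (\<lambda>x. \<phi> x * k) x = k *\<^sub>R classical_grad \<phi> x"
  by (simp add: vec_eq_iff partial_deriv_mult[OF test_function_differentiable[OF assms]])

lemma Lp_space_1_iff:
  "f \<in> Lp_space 1 \<Omega> \<longleftrightarrow> integrable (lebesgue_on \<Omega>) f" if "f \<in> borel_measurable (lebesgue_on \<Omega>)"
  using that by (simp add: Lp_space_def integrable_norm_iff)

text \<open>
  Pointwise form of the absorption step, applied with \<open>t = k - T\<^sub>k(u)\<close>, \<open>p = D \<phi>\<close>, \<open>q = \<phi> D T\<^sub>k(u)\<close> and
  \<open>b = A q\<close>. The difference of the two sides dominates \<open>(2 k M |p| - \<alpha> |q|)\<^sup>2 / (2 \<alpha>)\<close>.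
\<close>

lemma coercive_young:
  fixes p q :: "'a::euclidean_space"
  assumes "\<alpha> > 0" "0 \<le> t" "t \<le> k" "\<alpha> * (norm q)\<^sup>2 \<le> b \<bullet> q" "norm b \<le> M * norm q"
  shows "(2 * t) * (p \<bullet> b) - b \<bullet> q \<le> 2 * k\<^sup>2 * M\<^sup>2 / \<alpha> * (norm p)\<^sup>2 - \<alpha> / 2 * (norm q)\<^sup>2"
proof -
  have "p \<bullet> b \<le> norm p * (M * norm q)"
    using norm_cauchy_schwarz[of p b] mult_left_mono[OF assms(5) norm_ge_zero[of p]] by linarith
  moreover have "0 \<le> norm p * (M * norm q)"
    using assms(5) norm_ge_zero[of b] by (intro mult_nonneg_nonneg[OF norm_ge_zero]) linarith
  ultimately have "t * (p \<bullet> b) \<le> k * (norm p * (M * norm q))"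
    using assms(2,3) by (meson mult_left_mono mult_right_mono order_trans)
  moreover have "0 \<le> (2 * k * M * norm p - \<alpha> * norm q)\<^sup>2 / (2 * \<alpha>)"
    using assms(1) by simp
  then have "2 * (k * (norm p * (M * norm q))) \<le> 2 * k\<^sup>2 * M\<^sup>2 / \<alpha> * (norm p)\<^sup>2 + \<alpha> / 2 * (norm q)\<^sup>2"
    using assms(1) by (simp add: power2_diff power_mult_distrib power2_eq_square field_simps)
  ultimately show ?thesis
    using assms(4) by linarith
qed

text \<open>
  Write \<open>T = T\<^sub>k(u)\<close>, \<open>G = G\<^sub>k(u)\<close>. The solution is tested with \<open>v = \<phi>\<^sup>2 (k - T) \<ge> 0\<close>. Since \<open>D v = \<phi> z\<close> with
  \<open>z = 2 (k - T) D \<phi> - \<phi> D T\<close>, one has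
  \<open>- div (\<^sup>tA D v) = \<phi> (- div (\<^sup>tA z)) - \<^sup>tA z \<cdot> D \<phi>\<close>, so that a single product with the smooth factor \<open>\<phi>\<close>
  witnesses \<open>v \<in> V\<close>, and only the product rule for \<open>\<phi> T\<close> is needed to evaluate the identity. Because the
  right hand side is nonnegative and \<open>D v \<cdot> A D G\<close> vanishes, it reduces to \<open>\<integral> \<^sup>tA z \<cdot> (\<phi> D T) \<ge> 0\<close>.
\<close>

lemma caccioppoli_test_function:
  fixes \<Omega> :: "(real^'n) set" and A :: "real^'n \<Rightarrow> real^'n^'n"
  assumes \<Omega>: "open \<Omega>" "bounded \<Omega>"
    and A: "\<And>i j. (\<lambda>x. A x $ i $ j) \<in> Lp_space \<infinity> \<Omega>"
    and \<alpha>: "\<alpha> > 0"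
    and ell: "AE x in lebesgue_on \<Omega>. \<forall>\<xi>. (A x *v \<xi>) \<bullet> \<xi> \<ge> \<alpha> * (norm \<xi>)\<^sup>2"
    and sol: "is_solution \<Omega> A F u"
    and k: "k > 0" and \<phi>: "\<phi> \<in> test_functions \<Omega>"
  defines "DT \<equiv> weak_grad \<Omega> (\<lambda>y. trunc k (u y))"
  shows "(\<lambda>x. \<phi> x *\<^sub>R DT x) \<in> Lp_space 2 \<Omega>"
    and "(\<integral>x. (norm (\<phi> x *\<^sub>R DT x))\<^sup>2 \<partial>lebesgue_on \<Omega>)
      \<le> 4 * k\<^sup>2 * (matrix_Linf_norm \<Omega> A)\<^sup>2 / \<alpha>\<^sup>2 * (\<integral>x. (norm (classical_grad \<phi> x))\<^sup>2 \<partial>lebesgue_on \<Omega>)"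
    and "DT \<in> borel_measurable (lebesgue_on \<Omega>)"
proof -
  let ?M = "lebesgue_on \<Omega>" and ?m = "matrix_Linf_norm \<Omega> A"
  define T where "T x = trunc k (u x)" for x
  define G where "G x = trunc_rest k (u x)" for x
  define D\<phi> where "D\<phi> = classical_grad \<phi>"
  define q where "q x = \<phi> x *\<^sub>R DT x" for x
  note fin = finite_measure_lebesgue_on_open[OF \<Omega>]
  have u: "u \<in> Lp_space 2 \<Omega>" "u \<in> H1_loc \<Omega>" and u0: "AE x in ?M. u x \<ge> 0"
    and G: "G \<in> H10 \<Omega>"
    and TH: "\<And>\<phi>. \<phi> \<in> H10 \<Omega> \<Longrightarrow> \<phi> \<in> Lp_space \<infinity> \<Omega> \<Longrightarrow> (\<lambda>x. \<phi> x * T x) \<in> H10 \<Omega>"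
    using sol k unfolding is_solution_def T_def G_def[abs_def] by blast+
  have [measurable]: "u \<in> borel_measurable ?M" by (rule Lp_space_2_measurable[OF u(1)])
  have Tm[measurable]: "T \<in> borel_measurable ?M"
    unfolding T_def[abs_def] using borel_measurable_trunc by measurable
  have \<phi>m[measurable]: "\<phi> \<in> borel_measurable ?M" "D\<phi> \<in> borel_measurable ?M"
    unfolding D\<phi>_def by (rule test_function_measurable[OF \<phi>], rule classical_grad_measurable[OF \<phi>])
  have Tk: "\<bar>T x\<bar> \<le> k" for x unfolding T_def by (rule abs_trunc_le[OF k])
  have T0: "AE x in ?M. 0 \<le> T x \<and> T x \<le> k"
    using u0 by eventually_elim (simp add: T_def trunc_bounds[OF k])
  have D\<phi>2: "D\<phi> \<in> Lp_space 2 \<Omega>" unfolding D\<phi>_def by (rule test_function_Lp_space_2(2)[OF fin \<phi>])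

  \<comment> \<open>\<open>D T\<close> exists as a weak gradient because \<open>T = u - G\<close>.\<close>
  obtain gu where gu: "has_weak_gradient \<Omega> u gu"
    using u(2) unfolding H1_loc_def by blast
  note DG = H1_weak_grad[OF \<Omega>(1) H10_imp_H1[OF G]]
  have "has_weak_gradient \<Omega> T (\<lambda>x. gu x - weak_grad \<Omega> G x)"
    using has_weak_gradient_diff[OF \<Omega>(1) gu DG(1)]
    unfolding T_def[abs_def] G_def trunc_eq_diff_trunc_rest .
  from has_weak_gradient_weak_grad[OF this] have DT: "has_weak_gradient \<Omega> T DT"
    unfolding DT_def T_def[abs_def] .
  show DTm[measurable]: "DT \<in> borel_measurable ?M"
    using has_weak_gradientD(2)[OF DT] unfolding Lp_loc_1_iff by blast

  have \<phi>T: "(\<lambda>x. \<phi> x * T x) \<in> H10 \<Omega>"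
    by (rule TH[OF test_function_H10[OF \<Omega> \<phi>] test_function_Lp_space_infinity[OF \<phi>]])
  have D\<phi>T': "has_weak_gradient \<Omega> (\<lambda>x. \<phi> x * T x) (\<lambda>x. q x + T x *\<^sub>R D\<phi> x)"
    unfolding q_def D\<phi>_def by (rule has_weak_gradient_test_function_mult[OF \<Omega>(1) \<phi> DT])
  note D\<phi>T = weak_grad_eq_AE[OF \<Omega>(1) D\<phi>T']
  note \<phi>T2 = H1_weak_grad[OF \<Omega>(1) H10_imp_H1[OF \<phi>T]]
  have TD\<phi>2: "(\<lambda>x. T x *\<^sub>R D\<phi> x) \<in> Lp_space 2 \<Omega>"
    by (rule Lp_space_2_scaleR[OF D\<phi>2 Tm, of k]) (use Tk in auto)
  \<comment> \<open>\<open>\<phi> D T\<close> is the difference of \<open>D (\<phi> T)\<close> and \<open>T D \<phi>\<close>, both square integrable.\<close>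
  have qm[measurable]: "q \<in> borel_measurable ?M" unfolding q_def[abs_def] by measurable
  have q2: "q \<in> Lp_space 2 \<Omega>"
  proof (rule Lp_space_2_dominated[OF Lp_space_2_diff[OF \<phi>T2(3) TD\<phi>2] qm])
    show "AE x in ?M. norm (q x) \<le> 1 * norm (weak_grad \<Omega> (\<lambda>x. \<phi> x * T x) x - T x *\<^sub>R D\<phi> x)"
      using D\<phi>T by eventually_elim simp
  qed
  then show "(\<lambda>x. \<phi> x *\<^sub>R DT x) \<in> Lp_space 2 \<Omega>" unfolding q_def[abs_def] .

  \<comment> \<open>\<open>w = \<phi> (k - T)\<close> and \<open>v = \<phi> w\<close>, written as test function minus element of \<open>H10\<close>.\<close>
  define w where "w x = \<phi> x * k - \<phi> x * T x" for x
  define v where "v x = \<phi> x * \<phi> x * k - \<phi> x * \<phi> x * T x" for x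
  define z where "z x = (2 * (k - T x)) *\<^sub>R D\<phi> x - q x" for x
  have \<phi>k: "(\<lambda>x. \<phi> x * k) \<in> test_functions \<Omega>"
    by (rule test_function_mult[OF \<phi> Ck_const])
  have \<phi>\<phi>: "(\<lambda>x. \<phi> x * \<phi> x) \<in> test_functions \<Omega>"
    by (rule test_function_mult[OF \<phi> test_function_Ck[OF \<phi>]])
  have w: "w \<in> H10 \<Omega>"
    unfolding w_def[abs_def] by (rule test_function_diff_H10[OF \<Omega> \<phi>k \<phi>T])
  have v: "v \<in> H10 \<Omega>"
    unfolding v_def[abs_def]
    by (rule test_function_diff_H10[OF \<Omega> test_function_mult[OF \<phi>\<phi> Ck_const] TH[OF test_function_H10[OF \<Omega> \<phi>\<phi>] test_function_Lp_space_infinity[OF \<phi>\<phi>]]])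
  have "has_weak_gradient \<Omega> w (\<lambda>x. classical_grad (\<lambda>x. \<phi> x * k) x - (q x + T x *\<^sub>R D\<phi> x))"
    unfolding w_def[abs_def]
    by (rule has_weak_gradient_diff[OF \<Omega>(1) has_weak_gradient_test_function[OF \<Omega> \<phi>k] D\<phi>T'])
  then have Dw: "has_weak_gradient \<Omega> w (\<lambda>x. (k - T x) *\<^sub>R D\<phi> x - q x)"
    unfolding classical_grad_mult_const[OF \<phi>] D\<phi>_def by (simp add: algebra_simps)
  have vw: "v = (\<lambda>x. \<phi> x * w x)"
    by (rule ext) (simp add: v_def w_def algebra_simps)
  have zeq: "\<phi> x *\<^sub>R ((k - T x) *\<^sub>R D\<phi> x - q x) + w x *\<^sub>R D\<phi> x = \<phi> x *\<^sub>R z x" for x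
    by (simp add: z_def w_def algebra_simps flip: scaleR_left_distrib)
  have Dv: "has_weak_gradient \<Omega> v (\<lambda>x. \<phi> x *\<^sub>R z x)"
    using has_weak_gradient_test_function_mult[OF \<Omega>(1) \<phi> Dw] unfolding vw D\<phi>_def[symmetric] zeq .
  note Dv' = weak_grad_eq_AE[OF \<Omega>(1) Dv]
  have z2: "z \<in> Lp_space 2 \<Omega>"
    unfolding z_def[abs_def]
  proof (rule Lp_space_2_diff[OF Lp_space_2_scaleR[OF D\<phi>2, of _ "4 * k"] q2])
    show "AE x in ?M. \<bar>2 * (k - T x)\<bar> \<le> 4 * k"
    proof (rule AE_I2)
      fix x show "\<bar>2 * (k - T x)\<bar> \<le> 4 * k" using Tk[of x] k by (auto simp: abs_le_iff)
    qed
  qed measurable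
  have vLinf: "v \<in> Lp_space \<infinity> \<Omega>"
  proof -
    obtain C where C: "\<And>x. \<bar>\<phi> x * \<phi> x\<bar> \<le> C" using test_function_bounded[OF \<phi>\<phi>] by blast
    have "norm (v x) \<le> C * (2 * k)" for x
    proof -
      have "v x = (\<phi> x * \<phi> x) * (k - T x)" by (simp add: v_def algebra_simps)
      then have "norm (v x) = \<bar>\<phi> x * \<phi> x\<bar> * \<bar>k - T x\<bar>" by (simp only: real_norm_def abs_mult)
      also have "\<bar>k - T x\<bar> \<le> 2 * k" using Tk[of x] k by (auto simp: abs_le_iff)
      with C[of x] have "\<bar>\<phi> x * \<phi> x\<bar> * \<bar>k - T x\<bar> \<le> C * (2 * k)"
        using order_trans[OF abs_ge_zero C[of x]] by (intro mult_mono) auto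
      finally show ?thesis .
    qed
    moreover have "v \<in> borel_measurable ?M" unfolding v_def[abs_def] by measurable
    ultimately show ?thesis by (auto simp: Lp_space_def intro!: exI[of _ "C * (2 * k)"])
  qed
  have v0: "AE x in ?M. v x \<ge> 0"
    using T0
  proof eventually_elim
    case (elim x)
    have "v x = (\<phi> x * \<phi> x) * (k - T x)" by (simp add: v_def algebra_simps)
    then show ?case using elim by simp
  qed

  note Abound = matrix_Linf_norm_bound[OF A]
  \<comment> \<open>The decomposition of \<open>- div (\<^sup>tA D v)\<close>, with \<open>y = \<^sup>tA z\<close>.\<close>
  define y where "y x = transpose (A x) *v z x" for x
  define f where "f x = - (y x \<bullet> D\<phi> x)" for x
  have Am: "(\<lambda>x. transpose (A x) $ i $ j) \<in> borel_measurable ?M" for i j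
    using A[of j i] by (simp add: Lp_space_def transpose_def)
  have ym: "y \<in> borel_measurable ?M"
    unfolding y_def[abs_def]
    by (rule borel_measurable_matrix_vector_mult[OF Am Lp_space_2_measurable[OF z2]])
  have y2: "y \<in> Lp_space 2 \<Omega>"
  proof (rule Lp_space_2_dominated[OF z2 ym])
    show "AE x in ?M. norm (y x) \<le> ?m * norm (z x)"
      using Abound unfolding y_def by eventually_elim (rule norm_transpose_matrix_vector_le, blast)
  qed
  have fint: "integrable ?M f"
    unfolding f_def[abs_def] using integrable_inner_Lp_space_2[OF y2 D\<phi>2] by simp
  have tA: "(\<lambda>x. transpose (A x) *v weak_grad \<Omega> v x) \<in> borel_measurable ?M"
    by (rule borel_measurable_matrix_vector_mult[OF Am weak_grad_measurable[OF Dv]])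
  have tADv: "AE x in ?M. transpose (A x) *v weak_grad \<Omega> v x = \<phi> x *\<^sub>R y x"
    using Dv' by eventually_elim (simp add: y_def matrix_vector_mult_scaleR)
  have dec: "V_decomposition \<Omega> A v {0} (\<lambda>_. \<phi>) (\<lambda>_. y) f"
    unfolding V_decomposition_def
  proof (intro conjI ballI)
    show "\<phi> \<in> H10 \<Omega> \<inter> Lp_space \<infinity> \<Omega>"
      using test_function_H10[OF \<Omega> \<phi>] test_function_Lp_space_infinity[OF \<phi>] by blast
    show "f \<in> Lp_space 1 \<Omega>"
      using fint by (simp add: Lp_space_1_iff borel_measurable_integrable)
    fix \<psi> assume \<psi>: "\<psi> \<in> test_functions \<Omega>"
    let ?D\<psi> = "classical_grad \<psi>"
    note \<psi>2 = test_function_Lp_space_2[OF fin \<psi>]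
    have \<psi>m: "\<psi> \<in> borel_measurable ?M" "?D\<psi> \<in> borel_measurable ?M"
      by (rule test_function_measurable[OF \<psi>], rule classical_grad_measurable[OF \<psi>])
    obtain C where C: "\<And>x. \<bar>\<phi> x\<bar> \<le> C" using test_function_bounded[OF \<phi>] by blast
    obtain C' where C': "\<And>x. \<bar>\<psi> x\<bar> \<le> C'" using test_function_bounded[OF \<psi>] by blast
    have p2: "(\<lambda>x. \<phi> x *\<^sub>R ?D\<psi> x) \<in> Lp_space 2 \<Omega>" "(\<lambda>x. \<psi> x *\<^sub>R D\<phi> x) \<in> Lp_space 2 \<Omega>"
      by (rule Lp_space_2_scaleR[OF \<psi>2(2) \<phi>m(1), of C], simp add: C)
        (rule Lp_space_2_scaleR[OF D\<phi>2 \<psi>m(1), of C'], simp add: C')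
    have "distr_neg_div \<Omega> (\<lambda>x. transpose (A x) *v weak_grad \<Omega> v x) \<psi> = (\<integral>x. y x \<bullet> (\<phi> x *\<^sub>R ?D\<psi> x) \<partial>?M)"
      unfolding distr_neg_div_def
    proof (rule integral_cong_AE)
      show "(\<lambda>x. (transpose (A x) *v weak_grad \<Omega> v x) \<bullet> ?D\<psi> x) \<in> borel_measurable ?M"
        by (intro borel_measurable_inner tA \<psi>m)
      show "(\<lambda>x. y x \<bullet> (\<phi> x *\<^sub>R ?D\<psi> x)) \<in> borel_measurable ?M"
        by (intro borel_measurable_inner ym borel_measurable_scaleR \<phi>m \<psi>m)
      show "AE x in ?M. (transpose (A x) *v weak_grad \<Omega> v x) \<bullet> ?D\<psi> x = y x \<bullet> (\<phi> x *\<^sub>R ?D\<psi> x)"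
        using tADv by eventually_elim simp
    qed
    moreover have "distr_mult_neg_div \<Omega> \<phi> y \<psi>
        = (\<integral>x. y x \<bullet> (\<phi> x *\<^sub>R ?D\<psi> x + \<psi> x *\<^sub>R D\<phi> x) \<partial>?M)"
      unfolding distr_mult_neg_div_def
    proof (rule integral_cong_AE)
      note h = has_weak_gradient_test_function[OF \<Omega> test_function_mult[OF \<phi> test_function_Ck[OF \<psi>]]]
      show "(\<lambda>x. y x \<bullet> weak_grad \<Omega> (\<lambda>y. \<phi> y * \<psi> y) x) \<in> borel_measurable ?M"
        by (intro borel_measurable_inner ym weak_grad_measurable[OF h])
      show "(\<lambda>x. y x \<bullet> (\<phi> x *\<^sub>R ?D\<psi> x + \<psi> x *\<^sub>R D\<phi> x)) \<in> borel_measurable ?M"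
        by (intro borel_measurable_inner ym borel_measurable_add borel_measurable_scaleR \<phi>m \<psi>m)
      show "AE x in ?M. y x \<bullet> weak_grad \<Omega> (\<lambda>y. \<phi> y * \<psi> y) x = y x \<bullet> (\<phi> x *\<^sub>R ?D\<psi> x + \<psi> x *\<^sub>R D\<phi> x)"
        using weak_grad_eq_AE[OF \<Omega>(1) h] by eventually_elim (simp add: classical_grad_mult[OF \<phi> \<psi>] D\<phi>_def)
    qed
    moreover have "\<dots> = (\<integral>x. y x \<bullet> (\<phi> x *\<^sub>R ?D\<psi> x) \<partial>?M) - distr_fun \<Omega> f \<psi>"
      unfolding distr_fun_def f_def
      using integrable_inner_Lp_space_2[OF y2 p2(1)] integrable_inner_Lp_space_2[OF y2 p2(2)]
      by (simp add: inner_add_right mult.commute)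
    ultimately show "distr_neg_div \<Omega> (\<lambda>x. transpose (A x) *v weak_grad \<Omega> v x) \<psi>
        = (\<Sum>i\<in>{0}. distr_mult_neg_div \<Omega> \<phi> y \<psi>) + distr_fun \<Omega> f \<psi>"
      by simp
  qed (use y2 in auto)
  then have vV: "v \<in> V_space \<Omega> A"
    unfolding V_space_def using v vLinf by blast

  have E: "0 \<le> (\<integral>x. (transpose (A x) *v weak_grad \<Omega> v x) \<bullet> weak_grad \<Omega> G x \<partial>?M)
      + (\<integral>x. y x \<bullet> weak_grad \<Omega> (\<lambda>x. \<phi> x * T x) x \<partial>?M) + (\<integral>x. f x * T x \<partial>?M)"
  proof -
    have "(\<integral>x. (transpose (A x) *v weak_grad \<Omega> v x) \<bullet> weak_grad \<Omega> G x \<partial>?M)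
      + (\<Sum>i\<in>{0::nat}. \<integral>x. y x \<bullet> weak_grad \<Omega> (\<lambda>x. \<phi> x * T x) x \<partial>?M) + (\<integral>x. f x * T x \<partial>?M)
      = enn2real (\<integral>\<^sup>+x. F x (u x) * ennreal (v x) \<partial>?M)"
      using sol vV v0 dec k unfolding is_solution_def T_def G_def[abs_def] by blast
    then show ?thesis by simp
  qed
  \<comment> \<open>Almost everywhere \<open>G = 0\<close>, whence \<open>D G = 0\<close>, or \<open>T = k\<close>, whence \<open>w = 0\<close>, \<open>D w = 0\<close> and \<open>z = 0\<close>.
      On the level set \<open>{u = k}\<close> this is where the lemma on zero sets is indispensable.\<close>
  have DG0: "AE x in ?M. G x = 0 \<longrightarrow> weak_grad \<Omega> G x = 0"
    by (rule H10_weak_grad_eq_0_on_zero_set[OF \<Omega> G])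
  have Dw0: "AE x in ?M. w x = 0 \<longrightarrow> weak_grad \<Omega> w x = 0"
    by (rule H10_weak_grad_eq_0_on_zero_set[OF \<Omega> w])
  have "AE x in ?M. (transpose (A x) *v weak_grad \<Omega> v x) \<bullet> weak_grad \<Omega> G x = 0"
    using u0 DG0 Dw0 weak_grad_eq_AE[OF \<Omega>(1) Dw] tADv
  proof eventually_elim
    case (elim x)
    show ?case
    proof (cases "G x = 0")
      case True
      then show ?thesis using elim by simp
    next
      case False
      then have "T x = k"
        using trunc_eq_or_rest_eq_0[OF k elim(1)] by (simp add: T_def G_def)
      then have "z x = 0" using elim by (simp add: w_def z_def)
      then show ?thesis using elim by (simp add: y_def)
    qed
  qed
  then have E1: "(\<integral>x. (transpose (A x) *v weak_grad \<Omega> v x) \<bullet> weak_grad \<Omega> G x \<partial>?M) = 0"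
    by (rule integral_eq_zero_AE)
  have yq: "integrable ?M (\<lambda>x. y x \<bullet> q x)"
    by (rule integrable_inner_Lp_space_2[OF y2 q2])
  have "(\<integral>x. y x \<bullet> weak_grad \<Omega> (\<lambda>x. \<phi> x * T x) x \<partial>?M) = (\<integral>x. y x \<bullet> (q x + T x *\<^sub>R D\<phi> x) \<partial>?M)"
  proof (rule integral_cong_AE)
    show "(\<lambda>x. y x \<bullet> weak_grad \<Omega> (\<lambda>x. \<phi> x * T x) x) \<in> borel_measurable ?M"
      by (intro borel_measurable_inner ym weak_grad_measurable[OF D\<phi>T'])
    show "(\<lambda>x. y x \<bullet> (q x + T x *\<^sub>R D\<phi> x)) \<in> borel_measurable ?M"
      by (intro borel_measurable_inner ym borel_measurable_add borel_measurable_scaleR \<phi>m qm Tm)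
    show "AE x in ?M. y x \<bullet> weak_grad \<Omega> (\<lambda>x. \<phi> x * T x) x = y x \<bullet> (q x + T x *\<^sub>R D\<phi> x)"
      using D\<phi>T by eventually_elim simp
  qed
  also have "\<dots> = (\<integral>x. y x \<bullet> q x \<partial>?M) - (\<integral>x. f x * T x \<partial>?M)"
    using yq integrable_inner_Lp_space_2[OF y2 TD\<phi>2]
    unfolding f_def by (simp add: inner_add_right mult.commute)
  finally have E2: "0 \<le> (\<integral>x. y x \<bullet> q x \<partial>?M)"
    using E E1 by simp

  \<comment> \<open>Ellipticity and absorption of half of the quadratic term.\<close>
  let ?c = "2 * k\<^sup>2 * ?m\<^sup>2 / \<alpha>"
  have i1: "integrable ?M (\<lambda>x. (norm (D\<phi> x))\<^sup>2)" and i2: "integrable ?M (\<lambda>x. (norm (q x))\<^sup>2)"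
    using Lp_space_2_integrable[OF D\<phi>2] Lp_space_2_integrable[OF q2] by auto
  have "(\<integral>x. y x \<bullet> q x \<partial>?M) \<le> (\<integral>x. ?c * (norm (D\<phi> x))\<^sup>2 - \<alpha> / 2 * (norm (q x))\<^sup>2 \<partial>?M)"
  proof (rule integral_mono_AE[OF yq])
    show "integrable ?M (\<lambda>x. ?c * (norm (D\<phi> x))\<^sup>2 - \<alpha> / 2 * (norm (q x))\<^sup>2)"
      using i1 i2 by simp
    show "AE x in ?M. y x \<bullet> q x \<le> ?c * (norm (D\<phi> x))\<^sup>2 - \<alpha> / 2 * (norm (q x))\<^sup>2"
      using T0 ell Abound
    proof eventually_elim
      case (elim x)
      have "y x \<bullet> q x = (2 * (k - T x)) * (D\<phi> x \<bullet> (A x *v q x)) - (A x *v q x) \<bullet> q x"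
        unfolding y_def inner_transpose_matrix_vector z_def inner_diff_left inner_scaleR_left
        by (simp only: inner_commute)
      also have "\<dots> \<le> ?c * (norm (D\<phi> x))\<^sup>2 - \<alpha> / 2 * (norm (q x))\<^sup>2"
        using elim by (intro coercive_young \<alpha>) auto
      finally show ?case .
    qed
  qed
  with E2 have "\<alpha> / 2 * (\<integral>x. (norm (q x))\<^sup>2 \<partial>?M) \<le> ?c * (\<integral>x. (norm (D\<phi> x))\<^sup>2 \<partial>?M)"
    using i1 i2 by simp
  then show "(\<integral>x. (norm (\<phi> x *\<^sub>R DT x))\<^sup>2 \<partial>lebesgue_on \<Omega>)
      \<le> 4 * k\<^sup>2 * ?m\<^sup>2 / \<alpha>\<^sup>2 * (\<integral>x. (norm (classical_grad \<phi> x))\<^sup>2 \<partial>lebesgue_on \<Omega>)"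
    unfolding q_def D\<phi>_def using \<alpha> by (simp add: field_simps power2_eq_square)
qed

lemma H10_approx_sequence:
  fixes \<Omega> :: "(real^'n) set"
  assumes \<Omega>: "open \<Omega>" "bounded \<Omega>" and w: "w \<in> H10 \<Omega>"
  obtains \<phi> where "\<And>n. \<phi> n \<in> test_functions \<Omega>"
    "AE x in lebesgue_on \<Omega>. (\<lambda>n. \<phi> n x) \<longlonglongrightarrow> w x"
    "\<And>n. (\<integral>x. (norm (weak_grad \<Omega> w x - classical_grad (\<phi> n) x))\<^sup>2 \<partial>lebesgue_on \<Omega>) < inverse (real (Suc n))"
proof -
  let ?M = "lebesgue_on \<Omega>"
  note fin = finite_measure_lebesgue_on_open[OF \<Omega>]
  note wg = H1_weak_grad[OF \<Omega>(1) H10_imp_H1[OF w]]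
  have ex: "\<forall>n. \<exists>\<phi>. \<phi> \<in> test_functions \<Omega> \<and> (\<integral>x. (norm (w x - \<phi> x))\<^sup>2 \<partial>?M)
      + (\<integral>x. (norm (weak_grad \<Omega> w x - classical_grad \<phi> x))\<^sup>2 \<partial>?M) < inverse (real (Suc n))"
  proof
    fix n
    have "0 < inverse (real (Suc n))" by simp
    from H10_approx[OF \<Omega> w this] show "\<exists>\<phi>. \<phi> \<in> test_functions \<Omega> \<and> (\<integral>x. (norm (w x - \<phi> x))\<^sup>2 \<partial>?M)
        + (\<integral>x. (norm (weak_grad \<Omega> w x - classical_grad \<phi> x))\<^sup>2 \<partial>?M) < inverse (real (Suc n))"
      by blast
  qed
  from choice[OF ex] obtain \<phi> where \<phi>: "\<And>n. \<phi> n \<in> test_functions \<Omega>"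
    and lt: "\<And>n. (\<integral>x. (norm (w x - \<phi> n x))\<^sup>2 \<partial>?M)
      + (\<integral>x. (norm (weak_grad \<Omega> w x - classical_grad (\<phi> n) x))\<^sup>2 \<partial>?M) < inverse (real (Suc n))"
    by blast
  have nn: "0 \<le> (\<integral>x. (norm (w x - \<phi> n x))\<^sup>2 \<partial>?M)"
    "0 \<le> (\<integral>x. (norm (weak_grad \<Omega> w x - classical_grad (\<phi> n) x))\<^sup>2 \<partial>?M)" for n
    by (intro integral_nonneg_AE AE_I2; simp)+
  have "integrable ?M (\<lambda>x. (norm (w x - \<phi> n x))\<^sup>2)" for n
    by (rule Lp_space_2_integrable[OF Lp_space_2_diff[OF wg(2) test_function_Lp_space_2(1)[OF fin \<phi>]]])
  moreover have "(\<lambda>n. \<integral>x. norm ((norm (w x - \<phi> n x))\<^sup>2) \<partial>?M) \<longlonglongrightarrow> 0"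
  proof (rule Lim_null_comparison[OF _ LIMSEQ_inverse_real_of_nat])
    show "\<forall>\<^sub>F n in sequentially. norm (\<integral>x. norm ((norm (w x - \<phi> n x))\<^sup>2) \<partial>?M) \<le> inverse (real (Suc n))"
    proof (intro always_eventually allI)
      fix n show "norm (\<integral>x. norm ((norm (w x - \<phi> n x))\<^sup>2) \<partial>?M) \<le> inverse (real (Suc n))"
      proof -
        have "(\<integral>x. (norm (w x - \<phi> n x))\<^sup>2 \<partial>?M) \<le> inverse (real (Suc n))"
          using lt[of n] nn(2)[of n] by linarith
        then show ?thesis using nn(1)[of n] by simp
      qed
    qed
  qed
  ultimately obtain r where r: "strict_mono (r :: nat \<Rightarrow> nat)"
    "AE x in ?M. (\<lambda>n. (norm (w x - \<phi> (r n) x))\<^sup>2) \<longlonglongrightarrow> 0"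
    using tendsto_L1_AE_subseq[of ?M "\<lambda>n x. (norm (w x - \<phi> n x))\<^sup>2"] by auto
  show ?thesis
  proof (rule that[of "\<lambda>n. \<phi> (r n)"])
    show "AE x in ?M. (\<lambda>n. \<phi> (r n) x) \<longlonglongrightarrow> w x"
      using r(2)
    proof eventually_elim
      case (elim x)
      then have "(\<lambda>n. w x - \<phi> (r n) x) \<longlonglongrightarrow> 0"
        using tendsto_real_sqrt[OF elim] by (simp add: tendsto_rabs_zero_iff)
      from tendsto_diff[OF tendsto_const[of "w x"] this] show ?case by simp
    qed
    show "(\<integral>x. (norm (weak_grad \<Omega> w x - classical_grad (\<phi> (r n)) x))\<^sup>2 \<partial>?M) < inverse (real (Suc n))" for n
    proof -
      have "inverse (real (Suc (r n))) \<le> inverse (real (Suc n))"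
        using seq_suble[OF r(1), of n] by (intro le_imp_inverse_le) auto
      then show ?thesis using lt[of "r n"] nn[of "r n"] by linarith
    qed
  qed (rule \<phi>)
qed

text \<open>
  Passage from test functions to \<open>\<phi> \<in> H10\<close> by Fatou's lemma along an almost everywhere convergent
  approximation. The crude bound \<open>|D \<phi>\<^sub>n|\<^sup>2 \<le> 2 |D \<phi>|\<^sup>2 + 2 |D \<phi> - D \<phi>\<^sub>n|\<^sup>2\<close> doubles the constant \<open>4\<close> of the smooth case.
\<close>

lemma caccioppoli_H10:
  fixes \<Omega> :: "(real^'n) set" and A :: "real^'n \<Rightarrow> real^'n^'n"
  assumes \<Omega>: "open \<Omega>" "bounded \<Omega>"
    and A: "\<And>i j. (\<lambda>x. A x $ i $ j) \<in> Lp_space \<infinity> \<Omega>"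
    and \<alpha>: "\<alpha> > 0"
    and ell: "AE x in lebesgue_on \<Omega>. \<forall>\<xi>. (A x *v \<xi>) \<bullet> \<xi> \<ge> \<alpha> * (norm \<xi>)\<^sup>2"
    and sol: "is_solution \<Omega> A F u"
    and k: "k > 0" and \<phi>: "\<phi> \<in> H10 \<Omega>"
  defines "DT \<equiv> weak_grad \<Omega> (\<lambda>y. trunc k (u y))"
  shows "(\<lambda>x. \<phi> x *\<^sub>R DT x) \<in> Lp_space 2 \<Omega>"
    and "(Lp_norm 2 \<Omega> (\<lambda>x. \<phi> x *\<^sub>R DT x))\<^sup>2
      \<le> 8 * k\<^sup>2 / \<alpha>\<^sup>2 * (matrix_Linf_norm \<Omega> A)\<^sup>2 * (Lp_norm 2 \<Omega> (weak_grad \<Omega> \<phi>))\<^sup>2"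
proof -
  let ?M = "lebesgue_on \<Omega>"
  define c where "c = 4 * k\<^sup>2 * (matrix_Linf_norm \<Omega> A)\<^sup>2 / \<alpha>\<^sup>2"
  define D where "D = (\<integral>x. (norm (weak_grad \<Omega> \<phi> x))\<^sup>2 \<partial>?M)"
  have c: "0 \<le> c" unfolding c_def by simp
  have D: "0 \<le> D" unfolding D_def by (intro integral_nonneg_AE AE_I2) simp
  note fin = finite_measure_lebesgue_on_open[OF \<Omega>]
  note wg = H1_weak_grad[OF \<Omega>(1) H10_imp_H1[OF \<phi>]]
  obtain s where s: "\<And>n. s n \<in> test_functions \<Omega>" "AE x in ?M. (\<lambda>n. s n x) \<longlonglongrightarrow> \<phi> x"
    "\<And>n. (\<integral>x. (norm (weak_grad \<Omega> \<phi> x - classical_grad (s n) x))\<^sup>2 \<partial>?M) < inverse (real (Suc n))"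
    by (rule H10_approx_sequence[OF \<Omega> \<phi>]) (rule that)
  note cac = caccioppoli_test_function[OF \<Omega> A \<alpha> ell sol k s(1), folded DT_def c_def]
  have \<phi>m: "\<phi> \<in> borel_measurable ?M" by (rule Lp_space_2_measurable[OF wg(2)])
  have qm: "(\<lambda>x. \<phi> x *\<^sub>R DT x) \<in> borel_measurable ?M"
    by (intro borel_measurable_scaleR \<phi>m cac(3))
  have bd: "(\<integral>x. (norm (s n x *\<^sub>R DT x))\<^sup>2 \<partial>?M) \<le> c * (2 * D + 2 * inverse (real (Suc n)))" for n
  proof -
    note g2 = test_function_Lp_space_2(2)[OF fin s(1)[of n]]
    note d2 = Lp_space_2_diff[OF wg(3) g2]
    have "(\<integral>x. (norm (classical_grad (s n) x))\<^sup>2 \<partial>?M)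
        \<le> (\<integral>x. 2 * (norm (weak_grad \<Omega> \<phi> x))\<^sup>2 + 2 * (norm (weak_grad \<Omega> \<phi> x - classical_grad (s n) x))\<^sup>2 \<partial>?M)"
    proof (rule Bochner_Integration.integral_mono[OF Lp_space_2_integrable[OF g2]])
      show "integrable ?M (\<lambda>x. 2 * (norm (weak_grad \<Omega> \<phi> x))\<^sup>2 + 2 * (norm (weak_grad \<Omega> \<phi> x - classical_grad (s n) x))\<^sup>2)"
        using Lp_space_2_integrable[OF wg(3)] Lp_space_2_integrable[OF d2] by simp
      fix x
      show "(norm (classical_grad (s n) x))\<^sup>2 \<le> 2 * (norm (weak_grad \<Omega> \<phi> x))\<^sup>2
          + 2 * (norm (weak_grad \<Omega> \<phi> x - classical_grad (s n) x))\<^sup>2"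
        using norm_add_power2_le[of "weak_grad \<Omega> \<phi> x" "- (weak_grad \<Omega> \<phi> x - classical_grad (s n) x)"]
        by (simp add: norm_minus_commute)
    qed
    also have "\<dots> \<le> 2 * D + 2 * inverse (real (Suc n))"
      using Lp_space_2_integrable[OF wg(3)] Lp_space_2_integrable[OF d2] s(3)[of n]
      by (simp add: D_def del: of_nat_Suc)
    finally show ?thesis
      by (rule order_trans[OF cac(2)[of n] mult_left_mono[OF _ c]])
  qed
  have "(\<integral>\<^sup>+x. ennreal ((norm (\<phi> x *\<^sub>R DT x))\<^sup>2) \<partial>?M)
      = (\<integral>\<^sup>+x. liminf (\<lambda>n. ennreal ((norm (s n x *\<^sub>R DT x))\<^sup>2)) \<partial>?M)"
  proof (rule nn_integral_cong_AE)
    show "AE x in ?M. ennreal ((norm (\<phi> x *\<^sub>R DT x))\<^sup>2) = liminf (\<lambda>n. ennreal ((norm (s n x *\<^sub>R DT x))\<^sup>2))"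
      using s(2)
    proof eventually_elim
      case (elim x)
      have "(\<lambda>n. ennreal ((norm (s n x *\<^sub>R DT x))\<^sup>2)) \<longlonglongrightarrow> ennreal ((norm (\<phi> x *\<^sub>R DT x))\<^sup>2)"
        by (intro tendsto_ennrealI tendsto_intros elim)
      then show ?case by (intro lim_imp_Liminf[symmetric]) auto
    qed
  qed
  also have "\<dots> \<le> liminf (\<lambda>n. \<integral>\<^sup>+x. ennreal ((norm (s n x *\<^sub>R DT x))\<^sup>2) \<partial>?M)"
  proof (rule nn_integral_liminf)
    show "(\<lambda>x. ennreal ((norm (s n x *\<^sub>R DT x))\<^sup>2)) \<in> borel_measurable ?M" for n
      using Lp_space_2_measurable[OF cac(1)[of n]] by measurable
  qed
  also have "\<dots> \<le> liminf (\<lambda>n. ennreal (c * (2 * D + 2 * inverse (real (Suc n)))))"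
  proof (rule Liminf_mono, rule always_eventually, rule allI)
    fix n
    have "(\<integral>\<^sup>+x. ennreal ((norm (s n x *\<^sub>R DT x))\<^sup>2) \<partial>?M) = ennreal (\<integral>x. (norm (s n x *\<^sub>R DT x))\<^sup>2 \<partial>?M)"
      by (rule nn_integral_eq_integral[OF Lp_space_2_integrable[OF cac(1)]]) simp
    then show "(\<integral>\<^sup>+x. ennreal ((norm (s n x *\<^sub>R DT x))\<^sup>2) \<partial>?M)
        \<le> ennreal (c * (2 * D + 2 * inverse (real (Suc n))))"
      using bd[of n] by (simp only: ennreal_leI)
  qed
  also have "\<dots> = ennreal (c * (2 * D + 2 * 0))"
    by (intro lim_imp_Liminf tendsto_ennrealI tendsto_intros LIMSEQ_inverse_real_of_nat) auto
  finally have nn: "(\<integral>\<^sup>+x. ennreal ((norm (\<phi> x *\<^sub>R DT x))\<^sup>2) \<partial>?M) \<le> ennreal (2 * c * D)"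
    by (simp add: mult_ac)
  have int: "integrable ?M (\<lambda>x. (norm (\<phi> x *\<^sub>R DT x))\<^sup>2)"
  proof (rule integrableI_bounded)
    show "(\<lambda>x. (norm (\<phi> x *\<^sub>R DT x))\<^sup>2) \<in> borel_measurable ?M"
      using qm by measurable
    show "(\<integral>\<^sup>+x. ennreal (norm ((norm (\<phi> x *\<^sub>R DT x))\<^sup>2)) \<partial>?M) < \<infinity>"
      using le_less_trans[OF nn ennreal_less_top] by simp
  qed
  show "(\<lambda>x. \<phi> x *\<^sub>R DT x) \<in> Lp_space 2 \<Omega>"
    unfolding Lp_space_2_iff using qm int by blast
  have "ennreal (\<integral>x. (norm (\<phi> x *\<^sub>R DT x))\<^sup>2 \<partial>?M) \<le> ennreal (2 * c * D)"
    using nn nn_integral_eq_integral[OF int] by simp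
  then have "(\<integral>x. (norm (\<phi> x *\<^sub>R DT x))\<^sup>2 \<partial>?M) \<le> 2 * c * D"
    using c D by (simp add: ennreal_le_iff)
  then show "(Lp_norm 2 \<Omega> (\<lambda>x. \<phi> x *\<^sub>R DT x))\<^sup>2
      \<le> 8 * k\<^sup>2 / \<alpha>\<^sup>2 * (matrix_Linf_norm \<Omega> A)\<^sup>2 * (Lp_norm 2 \<Omega> (weak_grad \<Omega> \<phi>))\<^sup>2"
    unfolding Lp_norm_2_power2 D_def c_def by simp
qed

theorem proposition5p4:
  fixes \<Omega> :: "(real^'n) set"
    and A :: "real^'n \<Rightarrow> real^'n^'n"
    and \<alpha> r C\<^sub>S :: real
    and F :: "real^'n \<Rightarrow> real \<Rightarrow> ennreal"
    and h u :: "real^'n \<Rightarrow> real"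
    and \<Gamma> \<Gamma>' :: "real \<Rightarrow> real"
  assumes "open \<Omega>" and "bounded \<Omega>"
    and "\<And>i j. (\<lambda>x. A x $ i $ j) \<in> Lp_space \<infinity> \<Omega>"
    and "\<alpha> > 0"
    and "AE x in lebesgue_on \<Omega>. \<forall>\<xi>. (A x *v \<xi>) \<bullet> \<xi> \<ge> \<alpha> * (norm \<xi>)\<^sup>2"
    and "caratheodory \<Omega> F"
    and "AE x in lebesgue_on \<Omega>. h x \<ge> 0"
    and "CARD('n) \<ge> 3 \<Longrightarrow> r = 2 * real CARD('n) / (real CARD('n) + 2)"
    and "CARD('n) = 2 \<Longrightarrow> r > 1"
    and "CARD('n) = 1 \<Longrightarrow> r = 1"
    and "h \<in> Lp_space (ereal r) \<Omega>"
    and "\<And>s. s \<ge> 0 \<Longrightarrow> \<Gamma> s \<ge> 0"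
    and "\<And>s. s \<ge> 0 \<Longrightarrow> (\<Gamma> has_real_derivative \<Gamma>' s) (at s within {0..})"
    and "continuous_on {0..} \<Gamma>'"
    and "\<Gamma> 0 = 0"
    and "\<And>s. s > 0 \<Longrightarrow> \<Gamma>' s > 0"
    and "AE x in lebesgue_on \<Omega>. \<forall>s>0. F x s \<le> ennreal (h x / \<Gamma> s)"
    and "sobolev_constant \<Omega> (holder_conjugate r) C\<^sub>S"
    and "is_solution \<Omega> A F u"
  shows "\<forall>k>0. \<forall>\<phi>\<in>H10 \<Omega> \<inter> Lp_space \<infinity> \<Omega>.
    (\<lambda>x. \<phi> x *\<^sub>R weak_grad \<Omega> (\<lambda>y. trunc k (u y)) x) \<in> Lp_space 2 \<Omega> \<and>
    (Lp_norm 2 \<Omega> (\<lambda>x. \<phi> x *\<^sub>R weak_grad \<Omega> (\<lambda>y. trunc k (u y)) x))\<^sup>2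
      \<le> 32 * k\<^sup>2 / \<alpha>\<^sup>2 * (matrix_Linf_norm \<Omega> A)\<^sup>2 * (Lp_norm 2 \<Omega> (weak_grad \<Omega> \<phi>))\<^sup>2
        + C\<^sub>S\<^sup>2 / \<alpha>\<^sup>2 * ((Lp_norm (ereal r) \<Omega> h)\<^sup>2 / (\<Gamma> k)\<^sup>2) * (Lp_norm \<infinity> \<Omega> \<phi>)\<^sup>2"
proof (intro allI impI ballI conjI)
  fix k :: real and \<phi> assume k: "0 < k" and \<phi>: "\<phi> \<in> H10 \<Omega> \<inter> Lp_space \<infinity> \<Omega>"
  let ?DT = "weak_grad \<Omega> (\<lambda>y. trunc k (u y))"
  have \<phi>': "\<phi> \<in> H10 \<Omega>" using \<phi> by blast
  note cac = caccioppoli_H10[OF assms(1-5) assms(19) k \<phi>']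
  show "(\<lambda>x. \<phi> x *\<^sub>R ?DT x) \<in> Lp_space 2 \<Omega>" by (rule cac(1))
  let ?X = "k\<^sup>2 / \<alpha>\<^sup>2 * (matrix_Linf_norm \<Omega> A)\<^sup>2 * (Lp_norm 2 \<Omega> (weak_grad \<Omega> \<phi>))\<^sup>2"
  have "(Lp_norm 2 \<Omega> (\<lambda>x. \<phi> x *\<^sub>R ?DT x))\<^sup>2 \<le> 8 * ?X" using cac(2) by simp
  also have "\<dots> \<le> 32 * ?X" by (intro mult_right_mono) auto
  finally show "(Lp_norm 2 \<Omega> (\<lambda>x. \<phi> x *\<^sub>R ?DT x))\<^sup>2
      \<le> 32 * k\<^sup>2 / \<alpha>\<^sup>2 * (matrix_Linf_norm \<Omega> A)\<^sup>2 * (Lp_norm 2 \<Omega> (weak_grad \<Omega> \<phi>))\<^sup>2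
        + C\<^sub>S\<^sup>2 / \<alpha>\<^sup>2 * ((Lp_norm (ereal r) \<Omega> h)\<^sup>2 / (\<Gamma> k)\<^sup>2) * (Lp_norm \<infinity> \<Omega> \<phi>)\<^sup>2"
    by (simp add: add_increasing2)
qed

end
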